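(* Let $n\ge 5$ and $n\not\equiv 2\pmod 4$. Then the affine hull of $P^{\mathrm{core}}_{\mathrm{QTSASM}(n)}$ is $A_n$, and $$\dim\bigl(P_{\mathrm{QTSASM}(n)}\bigr)=\left\lfloor\frac{(n-1)^2}{4}\right\rfloor-2.$$
   Context: $[n]=\{1,\dots,n\}$. An $n\times n$ alternating sign matrix (ASM) is an $n\times n$ matrix with entries in $\{0,1,-1\}$ such that in each row and each column the non-zero entries alternate in sign and the first and last non-zero entries are $1$ (so every row and column sums to $1$). A QTSASM is an $n\times n$ ASM $X$ with $x_{i,j}=x_{j,n+1-i}$ for all $i,j\in[n]$. $P_{\mathrm{QTSASM}(n)}\subseteq\mathbb R^{n\times n}$ is the convex hull of all $n\times n$ QTSASMs. Let $k=\lfloor n/2\rfloor$, $\ell=\lceil n/2\rceil$, $C_n=[\ell]\times[k]$. The core of a QTSASM $X$ is $(x_{i,j})_{(i,j)\in C_n}$, and $P^{\mathrm{core}}_{\mathrm{QTSASM}(n)}\subseteq\mathbb R^{C_n}$ is the convex hull of the cores of all $n\times n$ QTSASMs. For $Y=(y_{i,j})\in\mathbb R^{C_n}$ and $i\in[k]$, let $\rho_i(Y)=\sum_{j=1}^{k}y_{i,j}+\sum_{j=k+1}^{n}y_{n+1-j,i}$, and, when $n$ is odd, let $\rho_{k+1}(Y)=\sum_{j=1}^{k}y_{k+1,j}$. The affine subspace $A_n\subseteq\mathbb R^{C_n}$ is defined as follows. If $n$ is even, $A_n$ is given by the equations $\rho_i(Y)=1$ for all $i\in[k]$, $y_{1,1}=0$,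 and $y_{k,k}=0$. If $n$ is odd, $A_n$ is given by the equations $\rho_i(Y)=1$ for all $i\in[k]$, $y_{1,1}=0$, and $\rho_{k+1}(Y)=1$ if $k$ is odd, respectively $\rho_{k+1}(Y)=0$ if $k$ is even. *)

theory Defs
  imports "HOL-Analysis.Analysis"
begin

text \<open>
  Matrices are elements of \<open>real ^ 'c ^ 'r\<close> whose index types are finite linear orders.
  The elements of such a type, listed in increasing order, are numbered from 1 upwards, so that
  \<open>entry X i j\<close> is $x_{i,j}$ with the usual 1-based natural number indices.
\<close>

definition pos :: "'a::{finite,linorder} \<Rightarrow> nat" where
  "pos a = card {b. b \<le> a}"

definition idx :: "nat \<Rightarrow> 'a::{finite,linorder}" where
  "idx i = (THE a. pos a = i)"

definition entry ::
    "real ^ 'c::{finite,linorder} ^ 'r::{finite,linorder} \<Rightarrow> nat \<Rightarrow> nat \<Rightarrow> real" where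
  "entry X i j = X $ idx i $ idx j"

lemma strict_mono_pos: "strict_mono (pos :: 'a::{finite,linorder} \<Rightarrow> nat)"
proof (rule strict_monoI)
  fix a b :: 'a
  assume "a < b"
  then have "b \<notin> {c. c \<le> a}" and "{c. c \<le> a} \<subseteq> {c. c \<le> b}"
    by auto
  then have "{c. c \<le> a} \<subset> {c. c \<le> b}"
    by blast
  then show "pos a < pos b"
    unfolding pos_def by (intro psubset_card_mono) auto
qed

lemma bij_betw_pos: "bij_betw pos (UNIV :: 'a::{finite,linorder} set) {1..CARD('a)}"
proof -
  have inj: "inj (pos :: 'a \<Rightarrow> nat)"
    using strict_mono_pos by (rule strict_mono_imp_inj_on)
  have "1 \<le> pos a \<and> pos a \<le> CARD('a)" for a :: 'a
  proof -
    have "card {a} \<le> card {b. b \<le> a}"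
      by (rule card_mono) auto
    moreover have "card {b. b \<le> a} \<le> CARD('a)"
      by (rule card_mono) auto
    ultimately show ?thesis
      by (simp add: pos_def)
  qed
  then have "range (pos :: 'a \<Rightarrow> nat) \<subseteq> {1..CARD('a)}"
    by auto
  moreover have "card (range (pos :: 'a \<Rightarrow> nat)) = card {1..CARD('a)}"
    by (simp add: card_image inj)
  ultimately have "range (pos :: 'a \<Rightarrow> nat) = {1..CARD('a)}"
    by (intro card_subset_eq) auto
  with inj show ?thesis
    by (simp add: bij_betw_def)
qed

lemma idx_pos [simp]: "idx (pos a) = a"
  unfolding idx_def
  by (rule the_equality) (auto dest: strict_mono_eq[OF strict_mono_pos, THEN iffD1])

lemma pos_idx [simp]:
  assumes "1 \<le> i" "i \<le> CARD('a::{finite,linorder})"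
  shows "pos (idx i :: 'a) = i"
proof -
  have "i \<in> range (pos :: 'a \<Rightarrow> nat)"
    using assms bij_betw_imp_surj_on[OF bij_betw_pos[where 'a = 'a]] by simp
  then show ?thesis
    by auto
qed

definition alternating_line :: "nat \<Rightarrow> (nat \<Rightarrow> real) \<Rightarrow> bool" where
  "alternating_line n x \<longleftrightarrow>
    (let zs = filter (\<lambda>a. a \<noteq> 0) (map x [1..<n + 1])
     in zs \<noteq> [] \<and> hd zs = 1 \<and> last zs = 1 \<and> successively (\<lambda>a b. sgn b = - sgn a) zs)"

definition is_ASM :: "real ^ 'n::{finite,linorder} ^ 'n::{finite,linorder} \<Rightarrow> bool" where
  "is_ASM X \<longleftrightarrow>
    (\<forall>i\<in>{1..CARD('n)}. \<forall>j\<in>{1..CARD('n)}. entry X i j \<in> {0, 1, -1}) \<and>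
    (\<forall>i\<in>{1..CARD('n)}. alternating_line CARD('n) (\<lambda>j. entry X i j)) \<and>
    (\<forall>j\<in>{1..CARD('n)}. alternating_line CARD('n) (\<lambda>i. entry X i j))"

definition is_QTSASM :: "real ^ 'n::{finite,linorder} ^ 'n::{finite,linorder} \<Rightarrow> bool" where
  "is_QTSASM X \<longleftrightarrow>
    is_ASM X \<and>
    (\<forall>i\<in>{1..CARD('n)}. \<forall>j\<in>{1..CARD('n)}. entry X i j = entry X j (CARD('n) + 1 - i))"

definition P_QTSASM :: "(real ^ 'n::{finite,linorder} ^ 'n::{finite,linorder}) set" where
  "P_QTSASM = convex hull {X. is_QTSASM X}"

text \<open>
  For \<open>CARD('l) = \<lceil>n/2\<rceil>\<close> and \<open>CARD('k) = \<lfloor>n/2\<rfloor>\<close>, the type \<open>real ^ 'k ^ 'l\<close> is the space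
  $\mathbb{R}^{C_n}$ with $C_n = [\ell] \times [k]$.
\<close>

definition core ::
    "real ^ 'n::{finite,linorder} ^ 'n::{finite,linorder} \<Rightarrow> real ^ 'k::{finite,linorder} ^ 'l::{finite,linorder}" where
  "core X = (\<chi> a b. entry X (pos a) (pos b))"

text \<open>The type argument is needed because the size of the matrices whose cores are taken
  does not show in the result type.\<close>

definition P_core_QTSASM ::
    "'n::{finite,linorder} itself \<Rightarrow> (real ^ 'k::{finite,linorder} ^ 'l::{finite,linorder}) set" where
  "P_core_QTSASM _ = convex hull (core ` {X :: real ^ 'n::{finite,linorder} ^ 'n::{finite,linorder}. is_QTSASM X})"

definition rho ::
    "nat \<Rightarrow> nat \<Rightarrow> real ^ 'k::{finite,linorder} ^ 'l::{finite,linorder} \<Rightarrow> real" where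
  "rho n i Y = (let k = n div 2 in
     (\<Sum>j = 1..k. entry Y i j) + (\<Sum>j = k + 1..n. entry Y (n + 1 - j) i))"

text \<open>The functional $\rho_{k+1}$, which is only used for odd \<open>n\<close> and is not the case
  $i = k + 1$ of the formula for \<open>rho\<close>.\<close>

definition rho_mid ::
    "nat \<Rightarrow> real ^ 'k::{finite,linorder} ^ 'l::{finite,linorder} \<Rightarrow> real" where
  "rho_mid n Y = (let k = n div 2 in \<Sum>j = 1..k. entry Y (k + 1) j)"

definition core_affine_space ::
    "nat \<Rightarrow> (real ^ 'k::{finite,linorder} ^ 'l::{finite,linorder}) set" where
  "core_affine_space n = (let k = n div 2 in
     if even n
     then {Y. (\<forall>i\<in>{1..k}. rho n i Y = 1) \<and> entry Y 1 1 = 0 \<and> entry Y k k = 0}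
     else {Y. (\<forall>i\<in>{1..k}. rho n i Y = 1) \<and> entry Y 1 1 = 0 \<and>
              rho_mid n Y = (if odd k then 1 else 0)})"

end

theory Submission
  imports Defs
begin

text \<open>
  The affine hull of the cores is the intersection of the hyperplanes containing them, so the task is
  to determine the linear functionals $c$ that are constant on all cores. The ASM condition is
  a condition on the first $\lceil n/2 \rceil$ rows, and row $i$ only involves the entries of the core
  in row $i$ and column $i$. A single entry $y_{a,b} = 1$ with $a \neq b$ makes rows $a$ and $b$
  valid, so perfect matchings of the row indices give cores.
  Comparing matchings that differ in one or two edges gives $c_{a,b} = u_a + u_b$ for $a \neq b$.
  Replacing two edges by a small block with a non-zero diagonal entry gives $c_{i,i} = 2 u_i$. So $c$ is
  $\sum_i u_i \rho_i$ up to its coefficients at the entries that vanish on all cores.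
\<close>

subsection \<open>Alternating lines\<close>

text \<open>Parity governs the whole proof. For n = 2k the sums of the rows 1..k add up to twice the
  sum of the core, so k is even and n = 2 (mod 4) admits no QTSASM; otherwise the perfect matchings
  exist. For odd n the middle row shows the core entries \<open>y (k+1) j\<close> twice,
  symmetrically about the centre. An edge from a to k+1 therefore forces the centre to be -1. For
  even k the index k+1 stays unmatched and the centre is 1. Exchanging two local configurations
  gives an equation for c only if both extend to full cores by the same remainder. So local
  configurations live on index sets whose complement can still be matched. A diagonal entry 1 at
  (i,i) is seen twice by row i, in columns i and n+1-i, so a -1 must lie between. If this is (i,j)
  with j > i, row j sees it in column n+1-i and needs a 1 on each side, one of them from a column
  index above it, that is from (a,j) with a < i. This leaves no room for i = 1, nor for i = k; for
  even n these two entries indeed vanish. For odd n the case i = k is rescued by the middle column,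
  with y(k,k) = -1 for odd k and 1 for even k.\<close>

lemma alternating_line_iff:
  assumes "sorted_wrt (<) ps" and "\<And>j. j \<in> set ps \<longleftrightarrow> j \<in> {1..n} \<and> x j \<noteq> 0"
  shows "alternating_line n x \<longleftrightarrow> ps \<noteq> [] \<and> x (hd ps) = 1 \<and> x (last ps) = 1 \<and>
    successively (\<lambda>i j. sgn (x j) = - sgn (x i)) ps"
proof -
  have "set (filter (\<lambda>j. x j \<noteq> 0) [1..<n + 1]) = set ps"
    by (rule set_eqI) (simp add: assms(2) less_Suc_eq_le del: upt_Suc)
  \<comment> \<open>A strictly sorted list is determined by its set, so any increasing enumeration
    of the support may replace the filtered list. The next three lemmas then only inspect one, three
    or five positions.\<close>
  then have "filter (\<lambda>j. x j \<noteq> 0) [1..<n + 1] = ps"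
    using assms(1) by (intro strict_sorted_equal sorted_wrt_filter) (simp_all del: upt_Suc)
  then have "filter (\<lambda>a. a \<noteq> 0) (map x [1..<n + 1]) = map x ps"
    by (simp add: filter_map o_def del: upt_Suc)
  then show ?thesis
    by (cases "ps = []")
      (auto simp: alternating_line_def hd_map last_map successively_map simp del: upt_Suc)
qed

lemma alternating_line_1:
  assumes "p \<in> {1..n}" and "\<And>j. j \<in> {1..n} \<Longrightarrow> x j = of_bool (j = p)"
  shows "alternating_line n x"
  using assms by (subst alternating_line_iff[where ps = "[p]"]) auto

lemma alternating_line_3:
  assumes "1 \<le> p" "p < q" "q < r" "r \<le> n"
    and "\<And>j. j \<in> {1..n} \<Longrightarrow> x j = of_bool (j = p) - of_bool (j = q) + of_bool (j = r)"
  shows "alternating_line n x"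
  using assms by (subst alternating_line_iff[where ps = "[p, q, r]"]) auto

lemma alternating_line_5:
  assumes "1 \<le> p" "p < q" "q < r" "r < s" "s < t" "t \<le> n"
    and "\<And>j. j \<in> {1..n} \<Longrightarrow> x j = of_bool (j = p) - of_bool (j = q) + of_bool (j = r)
      - of_bool (j = s) + of_bool (j = t)"
  shows "alternating_line n x"
  using assms by (subst alternating_line_iff[where ps = "[p, q, r, s, t]"]) auto

lemma alternating_line_cong:
  assumes "\<And>j. j \<in> {1..n} \<Longrightarrow> x j = y j"
  shows "alternating_line n x = alternating_line n y"
proof -
  have "map x [1..<n + 1] = map y [1..<n + 1]"
    using assms by (intro map_cong) auto
  then show ?thesis
    by (simp only: alternating_line_def)
qed

lemma alternating_line_reverse:
  assumes "alternating_line n x"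
  shows "alternating_line n (\<lambda>j. x (n + 1 - j))"
proof -
  have "map (\<lambda>j. x (n + 1 - j)) [1..<n + 1] = rev (map x [1..<n + 1])"
    by (rule nth_equalityI) (auto simp: rev_nth Suc_diff_Suc simp del: upt_Suc)
  then have "filter (\<lambda>a. a \<noteq> 0) (map (\<lambda>j. x (n + 1 - j)) [1..<n + 1])
      = rev (filter (\<lambda>a. a \<noteq> 0) (map x [1..<n + 1]))"
    by (simp only: rev_filter)
  moreover have "successively (\<lambda>a b. sgn b = - sgn a) (rev (filter (\<lambda>a. a \<noteq> 0) (map x [1..<n + 1])))"
    unfolding successively_rev
    by (rule successively_mono[where P = "\<lambda>a b. sgn b = - sgn a"])
      (use assms in \<open>simp_all add: alternating_line_def Let_def del: upt_Suc\<close>)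
  ultimately show ?thesis
    using assms unfolding alternating_line_def Let_def
    by (simp only: hd_rev last_rev rev_is_Nil_conv) simp
qed

text \<open>Consecutive entries cancel in pairs, and equality of first and last entry detects odd
  length. A non-empty prefix is again alternating with the same head.\<close>

lemma alternating_list_sums:
  fixes zs :: "real list"
  assumes "set zs \<subseteq> {1, -1}" "successively (\<lambda>a b. sgn b = - sgn a) zs" "zs \<noteq> []"
  shows "sum_list zs = of_bool (hd zs = last zs) * hd zs"
    and "m \<le> length zs \<Longrightarrow> sum_list (take m zs) \<in> {0, hd zs}"
proof -
  have *: "sum_list zs = (if hd zs = last zs then hd zs else 0)"
    if "set zs \<subseteq> {1, -1}" "successively (\<lambda>a b. sgn b = - sgn a) zs" "zs \<noteq> []" for zs :: "real list"
    using that
  proof (induction zs rule: induct_list012)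
    case (3 a b zs)
    then show ?case
      by (cases zs) auto
  qed auto
  show "sum_list zs = of_bool (hd zs = last zs) * hd zs"
    using *[OF assms] by simp
  assume "m \<le> length zs"
  show "sum_list (take m zs) \<in> {0, hd zs}"
  proof (cases "m = 0")
    case False
    have "successively (\<lambda>a b. sgn b = - sgn a) (take m zs)"
      using assms(2) by (metis append_take_drop_id successively_append_iff)
    then show ?thesis
      using *[of "take m zs"] False assms set_take_subset[of m zs] by (auto split: if_splits)
  qed simp
qed

lemma alternating_line_sums:
  assumes "alternating_line n x" and "\<And>j. j \<in> {1..n} \<Longrightarrow> x j \<in> {0, 1, -1}"
  shows "(\<Sum>j = 1..n. x j) = 1" and "m \<le> n \<Longrightarrow> (\<Sum>j = 1..m. x j) \<in> {0, 1}"
proof -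
  let ?f = "filter (\<lambda>a. a \<noteq> (0::real))"
  define zs where "zs = ?f (map x [1..<n + 1])"
  have "set zs \<subseteq> {1, -1}"
    using assms(2) by (fastforce simp: zs_def less_Suc_eq_le simp del: upt_Suc)
  then have zs: "set zs \<subseteq> {1, -1}" "successively (\<lambda>a b. sgn b = - sgn a) zs" "zs \<noteq> []"
      "hd zs = 1" "last zs = 1"
    using assms(1) unfolding alternating_line_def Let_def zs_def by (auto simp del: upt_Suc)
  have sum: "(\<Sum>j = 1..m. x j) = sum_list (?f (map x [1..<m + 1]))" for m
  proof -
    have "sum_list (?f xs) = sum_list xs" for xs :: "real list"
      by (induction xs) auto
    then show ?thesis
      by (simp add: interv_sum_list_conv_sum_set_nat atLeastLessThanSuc_atLeastAtMost del: upt_Suc)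
  qed
  show "(\<Sum>j = 1..n. x j) = 1"
    unfolding sum zs_def[symmetric] using alternating_list_sums(1)[OF zs(1-3)] zs by simp
  assume "m \<le> n"
  then have "[1..<n + 1] = [1..<m + 1] @ [m + 1..<n + 1]"
    by (metis add_le_mono1 le_add2 upt_add_eq_append le_add_diff_inverse)
  \<comment> \<open>Filtering commutes with cutting the line, so partial sums of the line are prefix
    sums of \<open>zs\<close>.\<close>
  then have "zs = ?f (map x [1..<m + 1]) @ ?f (map x [m + 1..<n + 1])"
    by (simp add: zs_def del: upt_Suc)
  then have "?f (map x [1..<m + 1]) = take (length (?f (map x [1..<m + 1]))) zs"
      "length (?f (map x [1..<m + 1])) \<le> length zs"
    by simp_all
  then show "(\<Sum>j = 1..m. x j) \<in> {0, 1}"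
    using alternating_list_sums(2)[OF zs(1-3)] zs(4) sum by metis
qed

subsection \<open>Matrices from their cores\<close>

definition mat_of :: "(nat \<Rightarrow> nat \<Rightarrow> real) \<Rightarrow> real ^ 'c::{finite,linorder} ^ 'r::{finite,linorder}" where
  "mat_of f = (\<chi> a b. f (pos a) (pos b))"

lemma pos_range: "1 \<le> pos a" "pos (a :: 'a::{finite,linorder}) \<le> CARD('a)"
  using bij_betwE[OF bij_betw_pos[where 'a = 'a]] by auto

lemma entry_mat_of [simp]:
  assumes "1 \<le> i" "i \<le> CARD('r::{finite,linorder})" "1 \<le> j" "j \<le> CARD('c::{finite,linorder})"
  shows "entry (mat_of f :: real ^ 'c::{finite,linorder} ^ 'r::{finite,linorder}) i j = f i j"
  using assms by (simp add: entry_def mat_of_def)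

lemma nth_eq_entry: "X $ a $ b = entry X (pos a) (pos b)"
  by (simp add: entry_def)

lemma mat_eqI:
  fixes X Y :: "real ^ 'c::{finite,linorder} ^ 'r::{finite,linorder}"
  assumes "\<And>i j. \<lbrakk>1 \<le> i; i \<le> CARD('r); 1 \<le> j; j \<le> CARD('c)\<rbrakk> \<Longrightarrow> entry X i j = entry Y i j"
  shows "X = Y"
  unfolding vec_eq_iff nth_eq_entry by (intro allI assms pos_range)

lemma entry_core:
  assumes "1 \<le> i" "i \<le> CARD('l::{finite,linorder})" "1 \<le> j" "j \<le> CARD('k::{finite,linorder})"
  shows "entry (core X :: real ^ 'k::{finite,linorder} ^ 'l::{finite,linorder}) i j = entry X i j"
  using assms by (simp add: core_def entry_def)

lemma sum_pos: "(\<Sum>a\<in>UNIV. f (pos (a :: 'a::{finite,linorder}))) = (\<Sum>i = 1..CARD('a). f i)"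
  by (rule sum.reindex_bij_betw[OF bij_betw_pos])

lemma inner_entry:
  fixes X Y :: "real ^ 'c::{finite,linorder} ^ 'r::{finite,linorder}"
  shows "X \<bullet> Y = (\<Sum>i = 1..CARD('r). \<Sum>j = 1..CARD('c). entry X i j * entry Y i j)"
  by (simp add: inner_vec_def nth_eq_entry sum_pos[symmetric] del: One_nat_def)

lemma entry_linear [simp]:
  "entry (X + Y) i j = entry X i j + entry Y i j"
  "entry (c *\<^sub>R X) i j = c * entry X i j"
  "entry 0 i j = 0"
  by (simp_all add: entry_def)

text \<open>Row \<open>i \<le> \<lceil>n/2\<rceil>\<close> of the quarter-turn symmetric matrix with core \<open>y\<close>; for odd \<open>n\<close> the
  centre of the matrix is stored as an additional entry of \<open>y\<close>, at \<open>k + 1, k + 1\<close>.\<close>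

definition row :: "nat \<Rightarrow> (nat \<Rightarrow> nat \<Rightarrow> real) \<Rightarrow> nat \<Rightarrow> nat \<Rightarrow> real" where
  "row n y i j = (if j \<le> n div 2 then y i j
     else if i \<le> n div 2 then y (n + 1 - j) i else y i (n + 1 - j))"

text \<open>Two quarter turns are a half turn, which sends position (i,j) to (n+1-i,n+1-j); this
  supplies the lower rows.\<close>

definition unfold_core :: "nat \<Rightarrow> (nat \<Rightarrow> nat \<Rightarrow> real) \<Rightarrow> nat \<Rightarrow> nat \<Rightarrow> real" where
  "unfold_core n y i j =
     (if i \<le> (n + 1) div 2 then row n y i j else row n y (n + 1 - i) (n + 1 - j))"

lemma unfold_core_turn:
  assumes "1 \<le> i" "i \<le> n" "1 \<le> j" "j \<le> n"
  shows "unfold_core n y i j = unfold_core n y j (n + 1 - i)"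
proof -
  define k where "k = n div 2"
  define l where "l = (n + 1) div 2"
  define i' where "i' = n + 1 - i"
  define j' where "j' = n + 1 - j"
  have eq: "n + 1 - i' = i" "n + 1 - j' = j"
    using assms by (auto simp: i'_def j'_def)
  have lin: "i + i' = k + l + 1" "j + j' = k + l + 1" "l = k \<or> l = k + 1"
    using assms by (auto simp: i'_def j'_def k_def l_def)
  \<comment> \<open>Reflection swaps the two halves and fixes the centre. With the reflected indices
    as atoms, each combination of positions is settled by the definitions.\<close>
  have "i \<le> k \<and> i' > l \<or> i = k + 1 \<and> i' = k + 1 \<and> l = k + 1 \<or> i > l \<and> i' \<le> k"
    "j \<le> k \<and> j' > l \<or> j = k + 1 \<and> j' = k + 1 \<and> l = k + 1 \<or> j > l \<and> j' \<le> k"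
    using lin by auto
  with \<open>l = k \<or> l = k + 1\<close> show ?thesis
    unfolding unfold_core_def row_def k_def[symmetric] l_def[symmetric] i'_def[symmetric]
      j'_def[symmetric] eq
    by (elim disjE conjE) simp_all
qed

text \<open>A partial core on the indices in \<open>Q\<close>. Row \<open>i\<close> reads only cells
  whose first or second coordinate is \<open>i\<close>, so blocks on disjoint index sets can be
  added without disturbing each other's rows.\<close>

definition block :: "nat \<Rightarrow> nat set \<Rightarrow> (nat \<Rightarrow> nat \<Rightarrow> real) \<Rightarrow> bool" where
  "block n Q y \<longleftrightarrow> (\<forall>i j. y i j \<in> {0, 1, -1} \<and> (y i j \<noteq> 0 \<longrightarrow> i \<in> Q \<and> j \<in> Q)) \<and>
    (\<forall>i\<in>Q. alternating_line n (row n y i))"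

lemma blockI:
  assumes "\<And>i j. y i j \<in> {0, 1, -1}" "\<And>i j. i \<notin> Q \<or> j \<notin> Q \<Longrightarrow> y i j = 0"
    "\<And>i. i \<in> Q \<Longrightarrow> alternating_line n (row n y i)"
  shows "block n Q y"
  using assms unfolding block_def by blast

lemma block_empty: "block n {} (\<lambda>i j. 0)"
  by (simp add: block_def)

lemma block_Un:
  assumes "block n Q y" "block n R z" "Q \<inter> R = {}"
  shows "block n (Q \<union> R) (\<lambda>i j. y i j + z i j)"
proof (rule blockI)
  have y: "y i j = 0" if "i \<notin> Q \<or> j \<notin> Q" for i j
    using that assms(1) by (auto simp: block_def)
  have z: "z i j = 0" if "i \<notin> R \<or> j \<notin> R" for i j
    using that assms(2) by (auto simp: block_def)
  show "y i j + z i j = 0" if "i \<notin> Q \<union> R \<or> j \<notin> Q \<union> R" for i j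
    using that y z by auto
  show "y i j + z i j \<in> {0, 1, -1}" for i j
  proof (cases "i \<in> Q")
    case True
    then have "z i j = 0"
      using assms(3) z by blast
    then show ?thesis
      using assms(1) by (simp add: block_def)
  next
    case False
    then have "y i j = 0"
      using y by blast
    then show ?thesis
      using assms(2) by (simp add: block_def)
  qed
  fix i
  assume "i \<in> Q \<union> R"
  then show "alternating_line n (row n (\<lambda>i j. y i j + z i j) i)"
  proof (cases "i \<in> Q")
    case True
    then have "row n (\<lambda>i j. y i j + z i j) i = row n y i"
      using assms(3) z by (auto simp: row_def fun_eq_iff)
    then show ?thesis
      using True assms(1) by (simp add: block_def)
  next
    case False
    then have "row n (\<lambda>i j. y i j + z i j) i = row n z i"
      using y by (auto simp: row_def fun_eq_iff)
    then show ?thesis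
      using False \<open>i \<in> Q \<union> R\<close> assms(2) by (simp add: block_def)
  qed
qed

text \<open>By the quarter-turn symmetry column \<open>j\<close> is row \<open>j\<close> read
  backwards, and a row below the middle is the reversal of one of the first rows. So the rows
  inspected by \<open>block\<close> control all lines.\<close>

lemma block_QTSASM:
  fixes n :: nat
  assumes "block n {1..(n + 1) div 2} y" and "CARD('n::{finite,linorder}) = n"
  shows "is_QTSASM (mat_of (unfold_core n y) :: real ^ 'n::{finite,linorder} ^ 'n::{finite,linorder})"
    (is "is_QTSASM ?X")
proof -
  have row: "alternating_line n (unfold_core n y i)" if "1 \<le> i" "i \<le> n" for i
  proof (cases "i \<le> (n + 1) div 2")
    case True
    then have "unfold_core n y i = row n y i"
      by (simp add: unfold_core_def fun_eq_iff)
    then show ?thesis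
      using True assms(1) \<open>1 \<le> i\<close> by (simp add: block_def)
  next
    case False
    then have "unfold_core n y i = (\<lambda>j. row n y (n + 1 - i) (n + 1 - j))"
      by (simp add: unfold_core_def fun_eq_iff)
    moreover have "n + 1 - i \<in> {1..(n + 1) div 2}"
      using False that by auto
    ultimately show ?thesis
      using assms(1) alternating_line_reverse[of n "row n y (n + 1 - i)"] unfolding block_def
      by auto
  qed
  have X: "entry ?X i j = unfold_core n y i j" if "i \<in> {1..n}" "j \<in> {1..n}" for i j
    using that assms(2) by simp
  have col: "entry ?X i j = unfold_core n y j (n + 1 - i)"
    if "i \<in> {1..n}" "j \<in> {1..n}" for i j
    using X[OF that] unfold_core_turn that by (metis atLeastAtMost_iff)
  have "entry ?X i j \<in> {0, 1, -1}" if "i \<in> {1..n}" "j \<in> {1..n}" for i j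
    unfolding X[OF that] using assms(1) unfolding unfold_core_def row_def block_def by presburger
  moreover have "alternating_line n (\<lambda>j. entry ?X i j)" if "i \<in> {1..n}" for i
    using row[of i] that X by (subst alternating_line_cong[OF X]) auto
  moreover have "alternating_line n (\<lambda>i. entry ?X i j)" if "j \<in> {1..n}" for j
    using alternating_line_reverse[OF row[of j]] that by (subst alternating_line_cong[OF col]) auto
  moreover have "entry ?X i j = entry ?X j (n + 1 - i)" if "i \<in> {1..n}" "j \<in> {1..n}" for i j
    unfolding col[OF that] by (rule X[symmetric]) (use that in auto)
  ultimately show ?thesis
    unfolding is_QTSASM_def is_ASM_def assms(2) by blast
qed

lemma core_unfold_core:
  fixes n :: nat
  assumes "CARD('n::{finite,linorder}) = n" "CARD('k::{finite,linorder}) = n div 2"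
    "CARD('l::{finite,linorder}) = (n + 1) div 2"
  shows "(core (mat_of (unfold_core n y) :: real ^ 'n::{finite,linorder} ^ 'n::{finite,linorder}) :: real ^ 'k::{finite,linorder} ^ 'l::{finite,linorder}) = mat_of y"
  by (rule mat_eqI) (use assms in \<open>auto simp: entry_core unfold_core_def row_def\<close>)

lemma rho_eq:
  assumes "CARD('l::{finite,linorder}) = (n + 1) div 2"
  shows "rho n i (Y :: real ^ 'k::{finite,linorder} ^ 'l::{finite,linorder}) =
    (\<Sum>j = 1..n div 2. entry Y i j) + (\<Sum>j = 1..(n + 1) div 2. entry Y j i)"
proof -
  have "(\<Sum>j = n div 2 + 1..n. entry Y (n + 1 - j) i) = (\<Sum>j = 1..(n + 1) div 2. entry Y j i)"
    by (rule sum.reindex_bij_witness[of _ "\<lambda>j. n + 1 - j" "\<lambda>j. n + 1 - j"]) auto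
  then show ?thesis
    by (simp add: rho_def Let_def)
qed

section \<open>Equations satisfied by every QTSASM\<close>

lemma QTSASM_turn:
  fixes X :: "real ^ 'n::{finite,linorder} ^ 'n::{finite,linorder}"
  assumes "is_QTSASM X" "1 \<le> i" "i \<le> CARD('n)" "1 \<le> j" "j \<le> CARD('n)"
  shows "entry X i j = entry X (CARD('n) + 1 - j) i"
proof -
  have "entry X (CARD('n) + 1 - j) i = entry X i (CARD('n) + 1 - (CARD('n) + 1 - j))"
    using assms by (intro assms(1)[unfolded is_QTSASM_def, THEN conjunct2, rule_format]) auto
  then show ?thesis
    using assms by simp
qed

lemma QTSASM_imp_ASM: "is_QTSASM X \<Longrightarrow> is_ASM X"
  by (simp add: is_QTSASM_def)

lemma QTSASM_entries:
  fixes X :: "real ^ 'n::{finite,linorder} ^ 'n::{finite,linorder}"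
  assumes "is_QTSASM X" "1 \<le> i" "i \<le> CARD('n)" "1 \<le> j" "j \<le> CARD('n)"
  shows "entry X i j \<in> {0, 1, -1}"
  using QTSASM_imp_ASM[OF assms(1)] assms(2-) by (simp add: is_ASM_def)

lemma QTSASM_row_sums:
  fixes X :: "real ^ 'n::{finite,linorder} ^ 'n::{finite,linorder}"
  assumes "is_QTSASM X" "1 \<le> i" "i \<le> CARD('n)"
  shows "(\<Sum>j = 1..CARD('n). entry X i j) = 1"
    and "m \<le> CARD('n) \<Longrightarrow> (\<Sum>j = 1..m. entry X i j) \<in> {0, 1}"
  using QTSASM_imp_ASM[OF assms(1)] assms(2-) alternating_line_sums[of "CARD('n)" "entry X i"]
  by (simp_all add: is_ASM_def)

lemma QTSASM_column_head:
  fixes X :: "real ^ 'n::{finite,linorder} ^ 'n::{finite,linorder}"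
  assumes "is_QTSASM X" "1 \<le> j" "j \<le> CARD('n)"
  shows "entry X 1 j \<ge> 0"
  using QTSASM_imp_ASM[OF assms(1)] assms(2-)
    alternating_line_sums(2)[of "CARD('n)" "\<lambda>i. entry X i j" 1]
  by (auto simp: is_ASM_def)

lemma QTSASM_row_split:
  fixes X :: "real ^ 'n::{finite,linorder} ^ 'n::{finite,linorder}"
  assumes "is_QTSASM X" and "CARD('n) = n" "1 \<le> i" "i \<le> n"
  shows "(\<Sum>j = 1..n. entry X i j) = (\<Sum>j = 1..n div 2. entry X i j) + (\<Sum>j = 1..(n + 1) div 2. entry X j i)"
proof -
  have "(\<Sum>j = n div 2 + 1..n. entry X i j) = (\<Sum>j = n div 2 + 1..n. entry X (n + 1 - j) i)"
    by (intro sum.cong refl, subst QTSASM_turn[OF assms(1)]) (use assms in auto)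
  also have "\<dots> = (\<Sum>j = 1..(n + 1) div 2. entry X j i)"
    by (rule sum.reindex_bij_witness[of _ "\<lambda>j. n + 1 - j" "\<lambda>j. n + 1 - j"]) auto
  finally have "(\<Sum>j = n div 2 + 1..n. entry X i j) = (\<Sum>j = 1..(n + 1) div 2. entry X j i)" .
  moreover have "(\<Sum>j = 1..n. entry X i j) = (\<Sum>j = 1..n div 2. entry X i j) + (\<Sum>j = n div 2 + 1..n. entry X i j)"
    by (use sum.ub_add_nat[of 1 "n div 2" "entry X i" "n - n div 2"] in simp)
  ultimately show ?thesis
    by simp
qed

text \<open>The first and last entries of the top row agree by symmetry. That row is non-negative
  with sum 1, so they cannot both be 1.\<close>

lemma QTSASM_corner:
  fixes X :: "real ^ 'n::{finite,linorder} ^ 'n::{finite,linorder}"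
  assumes X: "is_QTSASM X" and n: "CARD('n) \<ge> 2"
  shows "entry X 1 1 = 0"
proof -
  have "entry X 1 1 = entry X 1 CARD('n)"
    using QTSASM_turn[OF X, of 1 "CARD('n)"] n by simp
  moreover have "(\<Sum>j\<in>{1, CARD('n)}. entry X 1 j) \<le> (\<Sum>j = 1..CARD('n). entry X 1 j)"
    using n QTSASM_column_head[OF X] by (intro sum_mono2) auto
  ultimately have "2 * entry X 1 1 \<le> 1"
    using QTSASM_row_sums(1)[OF X, of 1] n by simp
  then show ?thesis
    using QTSASM_column_head[OF X, of 1] QTSASM_entries[OF X, of 1 1] n by auto
qed

text \<open>The symmetry makes the adjacent entries in columns k and k+1 of row k equal, which
  alternation allows only for 0: the partial sums before and after this pair both lie in {0, 1} and
  differ by twice the entry.\<close>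

lemma QTSASM_centre_even:
  fixes X :: "real ^ 'n::{finite,linorder} ^ 'n::{finite,linorder}"
  assumes X: "is_QTSASM X" and n: "CARD('n) = 2 * k" "k \<ge> 1"
  shows "entry X k k = 0"
proof -
  have "entry X k k = entry X k (Suc k)"
    using QTSASM_turn[OF X, of k "Suc k"] n by simp
  moreover have "(\<Sum>j = 1..Suc k. entry X k j) = (\<Sum>j = 1..k - 1. entry X k j) + entry X k k + entry X k (Suc k)"
    using n by (cases k) auto
  moreover have "(\<Sum>j = 1..Suc k. entry X k j) \<in> {0, 1}" "(\<Sum>j = 1..k - 1. entry X k j) \<in> {0, 1}"
    by (rule QTSASM_row_sums(2)[OF X]; use n in simp)+
  ultimately show ?thesis
    using QTSASM_entries[OF X, of k k] n by auto
qed

text \<open>Adding up the row sums of the rows \<open>1..k\<close> shows that the sum over the left half of the middle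
  row is congruent to \<open>k\<close> modulo 2.\<close>

lemma QTSASM_middle_odd:
  fixes X :: "real ^ 'n::{finite,linorder} ^ 'n::{finite,linorder}"
  assumes X: "is_QTSASM X" and n: "CARD('n) = 2 * k + 1"
  shows "(\<Sum>j = 1..k. entry X (k + 1) j) = (if odd k then 1 else 0)"
proof -
  let ?m = "\<Sum>j = 1..k. entry X (k + 1) j"
  have row: "1 = (\<Sum>j = 1..k. entry X i j) + (\<Sum>j = 1..k + 1. entry X j i)"
    if "1 \<le> i" "i \<le> k + 1" for i
    using QTSASM_row_split[OF X n] QTSASM_row_sums[OF X, of i] that n by simp
  have int: "entry X i j \<in> \<int>"
    if "1 \<le> i" "i \<le> k + 1" "1 \<le> j" "j \<le> k + 1" for i j
    using QTSASM_entries[OF X, of i j] that n by auto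
  have m: "?m \<in> {0, 1}"
    by (rule QTSASM_row_sums(2)[OF X]) (use n in auto)
  have "real k = (\<Sum>i = 1..k. 1)"
    by simp
  also have "\<dots> = (\<Sum>i = 1..k. (\<Sum>j = 1..k. entry X i j) + (\<Sum>j = 1..k. entry X j i) + entry X (k + 1) i)"
    by (intro sum.cong) (use row in \<open>auto simp: add.assoc\<close>)
  also have "\<dots> = 2 * (\<Sum>i = 1..k. \<Sum>j = 1..k. entry X i j) + ?m"
    using sum.swap[of "\<lambda>i j. entry X i j" "{1..k}" "{1..k}"] by (simp add: sum.distrib)
  finally have "real k = 2 * (\<Sum>i = 1..k. \<Sum>j = 1..k. entry X i j) + ?m" .
  moreover have "(\<Sum>i = 1..k. \<Sum>j = 1..k. entry X i j) \<in> \<int>"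
    using int by (intro Ints_sum) auto
  then obtain t where "(\<Sum>i = 1..k. \<Sum>j = 1..k. entry X i j) = of_int t"
    by (auto elim: Ints_cases)
  ultimately have "real k = 2 * of_int t + ?m"
    by simp
  with m have "int k = 2 * t \<and> ?m = 0 \<or> int k = 2 * t + 1 \<and> ?m = 1"
    by auto
  then have "even k \<and> ?m = 0 \<or> odd k \<and> ?m = 1"
    by (metis even_of_nat dvd_triv_left odd_two_times_div_two_succ even_plus_one_iff)
  then show ?thesis
    by auto
qed

lemma core_QTSASM_mem:
  fixes X :: "real ^ 'n::{finite,linorder} ^ 'n::{finite,linorder}" and n :: nat
  assumes X: "is_QTSASM X" and "n \<ge> 2" and n: "CARD('n) = n" "CARD('k::{finite,linorder}) = n div 2"
    "CARD('l::{finite,linorder}) = (n + 1) div 2"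
  shows "(core X :: real ^ 'k::{finite,linorder} ^ 'l::{finite,linorder}) \<in> core_affine_space n"
proof -
  have 1: "rho n i (core X :: real ^ 'k::{finite,linorder} ^ 'l::{finite,linorder}) = 1"
    if "1 \<le> i" "i \<le> n div 2" for i
  proof -
    have "rho n i (core X :: real ^ 'k::{finite,linorder} ^ 'l::{finite,linorder}) = (\<Sum>j = 1..n. entry X i j)"
      using that n QTSASM_row_split[OF X n(1), of i] by (simp add: rho_eq entry_core)
    then show ?thesis
      using QTSASM_row_sums(1)[OF X, of i] that n by simp
  qed
  have 2: "entry (core X :: real ^ 'k::{finite,linorder} ^ 'l::{finite,linorder}) 1 1 = 0"
    using QTSASM_corner[OF X] n \<open>n \<ge> 2\<close> by (simp add: entry_core)
  have 3: "entry (core X :: real ^ 'k::{finite,linorder} ^ 'l::{finite,linorder}) (n div 2) (n div 2) = 0"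
    if "even n"
    using QTSASM_centre_even[OF X, of "n div 2"] n \<open>n \<ge> 2\<close> that
    by (simp add: entry_core)
  have 4: "rho_mid n (core X :: real ^ 'k::{finite,linorder} ^ 'l::{finite,linorder}) = (if odd (n div 2) then 1 else 0)"
    if "odd n"
  proof -
    have *: "(n + 1) div 2 = n div 2 + 1" "2 * (n div 2) + 1 = n"
      using that by (auto elim!: oddE)
    then have "rho_mid n (core X :: real ^ 'k::{finite,linorder} ^ 'l::{finite,linorder}) = (\<Sum>j = 1..n div 2. entry X (n div 2 + 1) j)"
      using n unfolding rho_mid_def Let_def by (intro sum.cong) (auto simp: entry_core)
    then show ?thesis
      using QTSASM_middle_odd[OF X, of "n div 2"] n * by simp
  qed
  show ?thesis
    using 1 2 3 4 by (auto simp: core_affine_space_def Let_def)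
qed

subsection \<open>Superposable blocks\<close>

definition cells :: "(nat \<times> nat) set \<Rightarrow> (nat \<times> nat) set \<Rightarrow> nat \<Rightarrow> nat \<Rightarrow> real" where
  "cells P N i j = of_bool ((i, j) \<in> P) - of_bool ((i, j) \<in> N)"

text \<open>The core cell that row \<open>i\<close> reads in column \<open>j\<close>. Checking a row
  of an explicit block thus amounts to finding the columns whose cell lies in \<open>P\<close> or
  \<open>N\<close>.\<close>

definition row_cell :: "nat \<Rightarrow> nat \<Rightarrow> nat \<Rightarrow> nat \<times> nat" where
  "row_cell n i j = (if j \<le> n div 2 then (i, j)
     else if i \<le> n div 2 then (n + 1 - j, i) else (i, n + 1 - j))"

lemma row_cells:
  "row n (cells P N) i j = of_bool (row_cell n i j \<in> P) - of_bool (row_cell n i j \<in> N)"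
  by (simp add: row_def cells_def row_cell_def)

lemma alternating_cells_1:
  assumes "1 \<le> p" "p \<le> n"
    and "\<And>j. \<lbrakk>1 \<le> j; j \<le> n\<rbrakk> \<Longrightarrow> row_cell n i j \<in> P \<longleftrightarrow> j = p"
    and "\<And>j. \<lbrakk>1 \<le> j; j \<le> n\<rbrakk> \<Longrightarrow> row_cell n i j \<notin> N"
  shows "alternating_line n (row n (cells P N) i)"
  by (rule alternating_line_1[of p]) (use assms in \<open>simp_all add: row_cells\<close>)

lemma alternating_cells_3:
  assumes "1 \<le> p" "p < q" "q < r" "r \<le> n"
    and "\<And>j. \<lbrakk>1 \<le> j; j \<le> n\<rbrakk> \<Longrightarrow> row_cell n i j \<in> P \<longleftrightarrow> j = p \<or> j = r"
    and "\<And>j. \<lbrakk>1 \<le> j; j \<le> n\<rbrakk> \<Longrightarrow> row_cell n i j \<in> N \<longleftrightarrow> j = q"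
  shows "alternating_line n (row n (cells P N) i)"
  by (rule alternating_line_3[of p q r]) (use assms in \<open>auto simp: row_cells\<close>)

lemma alternating_cells_5:
  assumes "1 \<le> p" "p < q" "q < r" "r < s" "s < t" "t \<le> n"
    and "\<And>j. \<lbrakk>1 \<le> j; j \<le> n\<rbrakk> \<Longrightarrow> row_cell n i j \<in> P \<longleftrightarrow> j = p \<or> j = r \<or> j = t"
    and "\<And>j. \<lbrakk>1 \<le> j; j \<le> n\<rbrakk> \<Longrightarrow> row_cell n i j \<in> N \<longleftrightarrow> j = q \<or> j = s"
  shows "alternating_line n (row n (cells P N) i)"
  by (rule alternating_line_5[of p q r s t]) (use assms in \<open>auto simp: row_cells\<close>)

lemma block_cells:
  assumes "P \<subseteq> Q \<times> Q" "N \<subseteq> Q \<times> Q"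
    and "\<And>i. i \<in> Q \<Longrightarrow> alternating_line n (row n (cells P N) i)"
  shows "block n Q (cells P N)"
  using assms by (intro blockI) (auto simp: cells_def)

text \<open>Row \<open>a\<close> sees the single 1 in column \<open>b\<close>, row \<open>b\<close>
  sees it in the right half, in column \<open>n + 1 - a\<close>.\<close>

lemma block_edge:
  assumes k: "n div 2 = k" and "a \<noteq> b" "1 \<le> a" "a \<le> k" "1 \<le> b" "b \<le> k"
  shows "block n {a, b} (cells {(a, b)} {})"
    (is "block n ?Q (cells ?P ?N)")
proof (rule block_cells)
  have "alternating_line n (row n (cells ?P ?N) a)"
    using assms by (intro alternating_cells_1[of b]) (auto simp: row_cell_def)
  moreover have "alternating_line n (row n (cells ?P ?N) b)"
    using assms by (intro alternating_cells_1[of "n + 1 - a"]) (auto simp: row_cell_def)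
  ultimately show "alternating_line n (row n (cells ?P ?N) r)" if "r \<in> ?Q" for r
    using that by auto
qed auto

lemma block_centre:
  assumes n: "n = 2 * k + 1"
  shows "block n {k + 1} (cells {(k + 1, k + 1)} {})"
proof (rule block_cells)
  show "alternating_line n (row n (cells {(k + 1, k + 1)} {}) r)" if "r \<in> {k + 1}" for r
    using n that by (intro alternating_cells_1[of "k + 1"]) (auto simp: row_cell_def)
qed auto

text \<open>The 1 occurs in the middle row in the columns \<open>a\<close> and
  \<open>n + 1 - a\<close>, with the centre -1 between them.\<close>

lemma block_middle_edge:
  assumes n: "n = 2 * k + 1" and "1 \<le> a" "a \<le> k"
  shows "block n {a, k + 1} (cells {(k + 1, a)} {(k + 1, k + 1)})"
    (is "block n ?Q (cells ?P ?N)")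
proof (rule block_cells)
  have k: "n div 2 = k"
    using n by simp
  have "alternating_line n (row n (cells ?P ?N) a)"
    using assms k by (intro alternating_cells_1[of "k + 1"]) (auto simp: row_cell_def)
  moreover have "alternating_line n (row n (cells ?P ?N) (k + 1))"
    using assms k by (intro alternating_cells_3[of a "k + 1" "n + 1 - a"]) (auto simp: row_cell_def)
  ultimately show "alternating_line n (row n (cells ?P ?N) r)" if "r \<in> ?Q" for r
    using that by auto
qed auto

text \<open>An alternative to the edges {a,i} and {j,m} with a diagonal entry. The -1 at (i,j)
  separates the two copies of the diagonal 1 in row \<open>i\<close>. In row \<open>j\<close> it
  appears in column \<open>n + 1 - i\<close>, between the ones from (j,m) and (a,j); here
  \<open>a < i\<close> is what puts the latter to its right.\<close>

lemma block_diagonal: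
  assumes k: "n div 2 = k" and "1 \<le> a" "a < i" "i < j" "j \<le> k" "1 \<le> m" "m \<le> k" "m \<noteq> a" "m \<noteq> i" "m \<noteq> j"
  shows "block n {a, i, j, m} (cells {(i, i), (a, j), (j, m)} {(i, j)})"
    (is "block n ?Q (cells ?P ?N)")
proof (rule block_cells)
  have "alternating_line n (row n (cells ?P ?N) a)"
    using assms by (intro alternating_cells_1[of j]) (auto simp: row_cell_def)
  moreover have "alternating_line n (row n (cells ?P ?N) i)"
    using assms by (intro alternating_cells_3[of i j "n + 1 - i"]) (auto simp: row_cell_def)
  moreover have "alternating_line n (row n (cells ?P ?N) j)"
    using assms
    by (intro alternating_cells_3[of m "n + 1 - i" "n + 1 - a"]) (auto simp: row_cell_def)
  moreover have "alternating_line n (row n (cells ?P ?N) m)"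
    using assms by (intro alternating_cells_1[of "n + 1 - j"]) (auto simp: row_cell_def)
  ultimately show "alternating_line n (row n (cells ?P ?N) r)" if "r \<in> ?Q" for r
    using that by auto
qed auto

text \<open>The previous block with k+1 in the role of \<open>m\<close>. The core has no column k+1,
  so the edge to \<open>j\<close> is entered as (k+1,j). This leaves room even for k = 3.\<close>

lemma block_diagonal_middle:
  assumes n: "n = 2 * k + 1" and "1 \<le> a" "a < i" "i < j" "j \<le> k"
  shows "block n {a, i, j, k + 1} (cells {(i, i), (a, j), (k + 1, j)} {(i, j), (k + 1, k + 1)})"
    (is "block n ?Q (cells ?P ?N)")
proof (rule block_cells)
  have k: "n div 2 = k"
    using n by simp
  have "alternating_line n (row n (cells ?P ?N) a)"
    using assms k by (intro alternating_cells_1[of j]) (auto simp: row_cell_def)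
  moreover have "alternating_line n (row n (cells ?P ?N) i)"
    using assms k by (intro alternating_cells_3[of i j "n + 1 - i"]) (auto simp: row_cell_def)
  moreover have "alternating_line n (row n (cells ?P ?N) j)"
    using assms k
    by (intro alternating_cells_3[of "k + 1" "n + 1 - i" "n + 1 - a"]) (auto simp: row_cell_def)
  moreover have "alternating_line n (row n (cells ?P ?N) (k + 1))"
    using assms k by (intro alternating_cells_3[of j "k + 1" "n + 1 - j"]) (auto simp: row_cell_def)
  ultimately show "alternating_line n (row n (cells ?P ?N) r)" if "r \<in> ?Q" for r
    using that by auto
qed auto

text \<open>For the diagonal cell (k,k) no larger index \<open>j\<close> is available. As a -1 it
  shows in the columns k and k+2 of row k, and the 1 from the middle row falls exactly between the
  two copies.\<close>

lemma block_last_negative: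
  assumes n: "n = 2 * k + 1" and "1 \<le> a" "a < k" "1 \<le> b" "b < k" "a \<noteq> b"
  shows "block n {a, b, k, k + 1} (cells {(k, a), (b, k), (k + 1, k)} {(k, k), (k + 1, k + 1)})"
    (is "block n ?Q (cells ?P ?N)")
proof (rule block_cells)
  have k: "n div 2 = k"
    using n by simp
  have "alternating_line n (row n (cells ?P ?N) a)"
    using assms k by (intro alternating_cells_1[of "k + 2"]) (auto simp: row_cell_def)
  moreover have "alternating_line n (row n (cells ?P ?N) b)"
    using assms k by (intro alternating_cells_1[of k]) (auto simp: row_cell_def)
  moreover have "alternating_line n (row n (cells ?P ?N) k)"
    using assms k
    by (intro alternating_cells_5[of a k "k + 1" "k + 2" "n + 1 - b"]) (auto simp: row_cell_def)
  moreover have "alternating_line n (row n (cells ?P ?N) (k + 1))"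
    using assms k by (intro alternating_cells_3[of k "k + 1" "k + 2"]) (auto simp: row_cell_def)
  ultimately show "alternating_line n (row n (cells ?P ?N) r)" if "r \<in> ?Q" for r
    using that by auto
qed auto

text \<open>The opposite signs: the two copies of the 1 at (k,k) are separated by the -1 at (k+1,k).
  The centre is 1, as suits even k.\<close>

lemma block_last_positive:
  assumes n: "n = 2 * k + 1" and "1 \<le> a" "a < k"
  shows "block n {a, k, k + 1} (cells {(k, k), (k + 1, a), (k + 1, k + 1)} {(k + 1, k)})"
    (is "block n ?Q (cells ?P ?N)")
proof (rule block_cells)
  have k: "n div 2 = k"
    using n by simp
  have "alternating_line n (row n (cells ?P ?N) a)"
    using assms k by (intro alternating_cells_1[of "k + 1"]) (auto simp: row_cell_def)
  moreover have "alternating_line n (row n (cells ?P ?N) k)"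
    using assms k by (intro alternating_cells_3[of k "k + 1" "k + 2"]) (auto simp: row_cell_def)
  moreover have "alternating_line n (row n (cells ?P ?N) (k + 1))"
    using assms k
    by (intro alternating_cells_5[of a k "k + 1" "k + 2" "n + 1 - a"]) (auto simp: row_cell_def)
  ultimately show "alternating_line n (row n (cells ?P ?N) r)" if "r \<in> ?Q" for r
    using that by auto
qed auto

text \<open>For even k the left half of the middle row has sum 0, so its entries can only be
  compared with each other. This block does so for the columns \<open>a\<close> and
  \<open>j\<close>; the -1 at (k+1,j) costs row \<open>j\<close> the two extra ones from (j,m) and
  (b,j).\<close>

lemma block_middle:
  assumes n: "n = 2 * k + 1" and "1 \<le> a" "a < j" "j \<le> k" "1 \<le> b" "b \<le> k" "1 \<le> m" "m \<le> k"
    and "b \<noteq> a" "b \<noteq> j" "b \<noteq> m" "m \<noteq> a" "m \<noteq> j"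
  shows "block n {a, m, b, j, k + 1} (cells {(k + 1, a), (j, m), (b, j), (k + 1, k + 1)} {(k + 1, j)})"
    (is "block n ?Q (cells ?P ?N)")
proof (rule block_cells)
  have k: "n div 2 = k"
    using n by simp
  have "alternating_line n (row n (cells ?P ?N) a)"
    using assms k by (intro alternating_cells_1[of "k + 1"]) (auto simp: row_cell_def)
  moreover have "alternating_line n (row n (cells ?P ?N) m)"
    using assms k by (intro alternating_cells_1[of "n + 1 - j"]) (auto simp: row_cell_def)
  moreover have "alternating_line n (row n (cells ?P ?N) b)"
    using assms k by (intro alternating_cells_1[of j]) (auto simp: row_cell_def)
  moreover have "alternating_line n (row n (cells ?P ?N) j)"
    using assms k by (intro alternating_cells_3[of m "k + 1" "n + 1 - b"]) (auto simp: row_cell_def)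
  moreover have "alternating_line n (row n (cells ?P ?N) (k + 1))"
    using assms k
    by (intro alternating_cells_5[of a j "k + 1" "n + 1 - j" "n + 1 - a"]) (auto simp: row_cell_def)
  ultimately show "alternating_line n (row n (cells ?P ?N) r)" if "r \<in> ?Q" for r
    using that by auto
qed auto

text \<open>The centre stored in \<open>y\<close> does not belong to the core and is left out.\<close>

definition val :: "nat \<Rightarrow> (nat \<Rightarrow> nat \<Rightarrow> real) \<Rightarrow> (nat \<Rightarrow> nat \<Rightarrow> real) \<Rightarrow> real" where
  "val n c y = (\<Sum>i = 1..(n + 1) div 2. \<Sum>j = 1..n div 2. c i j * y i j)"

lemma val_linear [simp]:
  "val n c (\<lambda>i j. 0) = 0"
  "val n c (\<lambda>i j. y i j + z i j) = val n c y + val n c z"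
  "val n c (\<lambda>i j. y i j - z i j) = val n c y - val n c z"
  by (simp_all add: val_def distrib_left right_diff_distrib sum.distrib sum_subtractf)

lemma val_cells:
  assumes "finite P" "finite N" and "P \<union> N \<subseteq> {1..(n + 1) div 2} \<times> {1..}"
  shows "val n c (cells P N) = (\<Sum>(i, j)\<in>P. if j \<le> n div 2 then c i j else 0)
    - (\<Sum>(i, j)\<in>N. if j \<le> n div 2 then c i j else 0)"
proof -
  have *: "(\<Sum>i = 1..(n + 1) div 2. \<Sum>j = 1..n div 2. c i j * of_bool ((i, j) \<in> S))
      = (\<Sum>(i, j)\<in>S. if j \<le> n div 2 then c i j else 0)"
    if "finite S" "S \<subseteq> {1..(n + 1) div 2} \<times> {1..}" for S
  proof -
    let ?D = "{1..(n + 1) div 2} \<times> {1..n div 2}"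
    have "(\<Sum>i = 1..(n + 1) div 2. \<Sum>j = 1..n div 2. c i j * of_bool ((i, j) \<in> S))
        = (\<Sum>p\<in>?D. if p \<in> S then case p of (i, j) \<Rightarrow> c i j else 0)"
      unfolding sum.cartesian_product by (intro sum.cong) auto
    also have "\<dots> = (\<Sum>p\<in>?D \<inter> S. case p of (i, j) \<Rightarrow> c i j)"
      by (intro sum.inter_restrict[symmetric]) auto
    also have "\<dots> = (\<Sum>p\<in>S \<inter> ?D. case p of (i, j) \<Rightarrow> if j \<le> n div 2 then c i j else 0)"
      by (intro sum.cong) auto
    also have "\<dots> = (\<Sum>p\<in>S. case p of (i, j) \<Rightarrow> if j \<le> n div 2 then c i j else 0)"
      using that by (intro sum.mono_neutral_left) (auto split: if_splits)
    finally show ?thesis .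
  qed
  have "val n c (cells P N) = (\<Sum>i = 1..(n + 1) div 2. \<Sum>j = 1..n div 2. c i j * of_bool ((i, j) \<in> P))
      - (\<Sum>i = 1..(n + 1) div 2. \<Sum>j = 1..n div 2. c i j * of_bool ((i, j) \<in> N))"
    by (simp only: val_def cells_def right_diff_distrib sum_subtractf)
  moreover have "P \<subseteq> {1..(n + 1) div 2} \<times> {1..}" "N \<subseteq> {1..(n + 1) div 2} \<times> {1..}"
    using assms(3) by auto
  ultimately show ?thesis
    using assms(1,2) by (simp only: *)
qed

text \<open>For even \<open>k\<close>, the vertex \<open>k + 1\<close> is matched with the centre of the matrix.\<close>

definition matched :: "nat \<Rightarrow> nat set \<Rightarrow> nat set" where
  "matched k R = (if even k then R - {k + 1} else R)"

text \<open>A perfect matching covers each index once, so edge weights \<open>u a + u b\<close> add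
  up to the sum of \<open>u\<close>. The block is chosen before \<open>c\<close> and
  \<open>u\<close>, so the lemma also serves as a plain existence statement.\<close>

lemma block_matching_even:
  assumes "n div 2 = k" "R \<subseteq> {1..k}" "even (card R)"
  shows "\<exists>w. block n R w \<and> (\<forall>c u. (\<forall>a\<in>R. \<forall>b\<in>R. a \<noteq> b \<longrightarrow> c a b = u a + u b) \<longrightarrow> val n c w = sum u R)"
  using assms(2,3)
proof (induction "card R" arbitrary: R rule: less_induct)
  case less
  have fin: "finite R"
    using less.prems(1) finite_subset by blast
  show ?case
  proof (cases "R = {}")
    case True
    then show ?thesis
      using block_empty by (intro exI[of _ "\<lambda>i j. 0"]) simp
  next
    case False
    then obtain a where a: "a \<in> R"
      by auto
    moreover from this less.prems(2) fin have "R \<noteq> {a}"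
      by auto
    ultimately obtain b where b: "b \<in> R" "a \<noteq> b"
      by auto
    define S where "S = R - {a, b}"
    have R: "R = {a, b} \<union> S" "a \<notin> S" "b \<notin> S" "finite S"
      using a b fin by (auto simp: S_def)
    then have card: "card R = card S + 2"
      using b by simp
    then obtain w where w: "block n S w"
      "\<And>c u. (\<forall>a\<in>S. \<forall>b\<in>S. a \<noteq> b \<longrightarrow> c a b = u a + u b) \<Longrightarrow> val n c w = sum u S"
      using less.hyps[of S] less.prems R by auto
    have ab: "1 \<le> a" "a \<le> k" "1 \<le> b" "b \<le> k"
      using a b less.prems(1) by auto
    have "block n R (\<lambda>i j. cells {(a, b)} {} i j + w i j)"
      unfolding R(1) using block_edge[OF assms(1) b(2) ab] w(1) R by (intro block_Un) auto
    moreover have "val n c (\<lambda>i j. cells {(a, b)} {} i j + w i j) = sum u R"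
      if "\<forall>a\<in>R. \<forall>b\<in>R. a \<noteq> b \<longrightarrow> c a b = u a + u b" for c u
    proof -
      have "val n c w = sum u S" "c a b = u a + u b"
        using that R(1) b a by (auto intro!: w(2))
      then show ?thesis
        using ab b(2) R assms(1) by (simp add: val_cells)
    qed
    ultimately show ?thesis
      by blast
  qed
qed

text \<open>The middle index needs an extra piece: the centre alone for even k, an edge to some
  \<open>a\<close> for odd k. What remains is an even set of ordinary indices.\<close>

lemma block_matching:
  assumes k: "n div 2 = k" and "R \<subseteq> {1..(n + 1) div 2}" "even (card (matched k R))"
  shows "\<exists>w. block n R w \<and>
    (\<forall>c u. (\<forall>a\<in>R. \<forall>b\<in>R. a \<noteq> b \<and> b \<le> k \<longrightarrow> c a b = u a + u b) \<longrightarrow> val n c w = sum u (matched k R))"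
proof (cases "k + 1 \<in> R")
  case False
  have "x \<in> {1..k}" if "x \<in> R" for x
  proof -
    have "1 \<le> x" "x \<le> (n + 1) div 2" "x \<noteq> k + 1"
      using that False assms(2) by auto
    then show ?thesis
      using k by simp
  qed
  then have R: "R \<subseteq> {1..k}" "matched k R = R"
    using False by (auto simp: matched_def)
  then obtain w where w: "block n R w"
    "\<And>c u. (\<forall>a\<in>R. \<forall>b\<in>R. a \<noteq> b \<longrightarrow> c a b = u a + u b) \<Longrightarrow> val n c w = sum u R"
    using block_matching_even[OF k, of R] assms(3) by auto
  have le: "b \<le> k" if "b \<in> R" for b
    using R(1) that by auto
  have "val n c w = sum u (matched k R)"
    if "\<forall>a\<in>R. \<forall>b\<in>R. a \<noteq> b \<and> b \<le> k \<longrightarrow> c a b = u a + u b" for c u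
    unfolding R(2) using that le by (intro w(2)) simp
  with w(1) show ?thesis
    by blast
next
  case True
  then have "k + 1 \<le> (n + 1) div 2"
    using assms(2) by (meson atLeastAtMost_iff subsetD)
  then have n: "n = 2 * k + 1"
    using k by presburger
  have R: "x \<in> {1..k}" if "x \<in> R" "x \<noteq> k + 1" for x
  proof -
    have "1 \<le> x" "x \<le> k + 1"
      using that n assms(2) by auto
    then show ?thesis
      using that(2) by simp
  qed
  have fin: "finite R"
    using assms(2) finite_subset by blast
  show ?thesis
  proof (cases "even k")
    case True
    define S where "S = R - {k + 1}"
    have S: "S \<subseteq> {1..k}" "R = {k + 1} \<union> S" "matched k R = S"
      using R True \<open>k + 1 \<in> R\<close> unfolding S_def matched_def by (blast, blast, simp)
    have le: "b \<le> k" if "b \<in> S" for b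
      using S(1) that by auto
    from S obtain w where w: "block n S w"
      "\<And>c u. (\<forall>a\<in>S. \<forall>b\<in>S. a \<noteq> b \<longrightarrow> c a b = u a + u b) \<Longrightarrow> val n c w = sum u S"
      using block_matching_even[OF k, of S] assms(3) by auto
    have "block n R (\<lambda>i j. cells {(k + 1, k + 1)} {} i j + w i j)"
      unfolding S(2) using block_centre[OF n] w(1) by (intro block_Un) (auto simp: S_def)
    moreover have "val n c (\<lambda>i j. cells {(k + 1, k + 1)} {} i j + w i j) = sum u (matched k R)"
      if "\<forall>a\<in>R. \<forall>b\<in>R. a \<noteq> b \<and> b \<le> k \<longrightarrow> c a b = u a + u b" for c u
    proof -
      have "val n c w = sum u S"
        using that le S(2) by (intro w(2)) simp
      then show ?thesis
        using k n by (simp add: S(3) val_cells)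
    qed
    ultimately show ?thesis
      by blast
  next
    case False
    then have even: "even (card R)" and m: "matched k R = R"
      using assms(3) by (auto simp: matched_def)
    have "R \<noteq> {k + 1}"
    proof
      assume "R = {k + 1}"
      then have "card R = 1"
        by (rule ssubst) simp
      with even show False
        by simp
    qed
    then obtain a where a: "a \<in> R" "a \<noteq> k + 1"
      using \<open>k + 1 \<in> R\<close> by blast
    then have ak: "1 \<le> a" "a \<le> k"
      using R by auto
    define S where "S = R - {a, k + 1}"
    have S: "S \<subseteq> {1..k}" "R = {a, k + 1} \<union> S" "a \<notin> S" "k + 1 \<notin> S" "finite S"
      using R a \<open>k + 1 \<in> R\<close> fin unfolding S_def by blast+
    have le: "b \<le> k" if "b \<in> S" for b
      using S(1) that by auto
    have "card R = card S + 2"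
      using S ak by simp
    then obtain w where w: "block n S w"
      "\<And>c u. (\<forall>a\<in>S. \<forall>b\<in>S. a \<noteq> b \<longrightarrow> c a b = u a + u b) \<Longrightarrow> val n c w = sum u S"
      using block_matching_even[OF k, of S] even S by auto
    let ?y = "\<lambda>i j. cells {(k + 1, a)} {(k + 1, k + 1)} i j + w i j"
    have "block n R ?y"
      unfolding S(2) using block_middle_edge[OF n ak] w(1) S by (intro block_Un) auto
    moreover have "val n c ?y = sum u (matched k R)"
      if "\<forall>a\<in>R. \<forall>b\<in>R. a \<noteq> b \<and> b \<le> k \<longrightarrow> c a b = u a + u b" for c u
    proof -
      have "val n c w = sum u S"
        using that le S(2) by (intro w(2)) simp
      moreover have "c (k + 1) a = u (k + 1) + u a"
        using that a ak \<open>k + 1 \<in> R\<close> by auto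
      moreover have "sum u R = u (k + 1) + u a + sum u S"
        using S ak by simp
      ultimately show ?thesis
        using k ak n by (simp add: m val_cells)
    qed
    ultimately show ?thesis
      by blast
  qed
qed

text \<open>The congruence condition excludes n = 2k with odd k, the one case in which the number of
  indices to be matched would be odd.\<close>

lemma card_matched_all:
  assumes "n div 2 = k" "n mod 4 \<noteq> 2"
  shows "even (card (matched k {1..(n + 1) div 2}))"
    and "matched k {1..(n + 1) div 2} = {1..if even k then k else k + 1}"
proof -
  have "even k \<and> n = 2 * k \<or> even k \<and> n = 2 * k + 1 \<or> odd k \<and> n = 2 * k + 1"
    using assms by presburger
  then show eq: "matched k {1..(n + 1) div 2} = {1..if even k then k else k + 1}"
    by (elim disjE) (auto simp: matched_def)
  show "even (card (matched k {1..(n + 1) div 2}))"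
    unfolding eq by auto
qed

text \<open>The parity assumption lets one matching on the complement of \<open>Q\<close> complete
  both blocks. The two full blocks have the same value, and the common part cancels.\<close>

lemma val_exchange:
  assumes k: "n div 2 = k" and n: "n mod 4 \<noteq> 2"
    and const: "\<And>y. block n {1..(n + 1) div 2} y \<Longrightarrow> val n c y = d"
    and y: "block n Q y" and z: "block n Q z"
    and Q: "Q \<subseteq> {1..(n + 1) div 2}" "even (card (matched k Q))"
  shows "val n c y = val n c z"
proof -
  define R where "R = {1..(n + 1) div 2} - Q"
  have un: "{1..(n + 1) div 2} = Q \<union> R" "Q \<inter> R = {}"
    using Q by (auto simp: R_def)
  have "matched k {1..(n + 1) div 2} = matched k Q \<union> matched k R" "matched k Q \<inter> matched k R = {}"
    "finite (matched k Q)" "finite (matched k R)"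
    using un finite_subset[OF Q(1)] by (auto simp: matched_def R_def)
  then have "card (matched k {1..(n + 1) div 2}) = card (matched k Q) + card (matched k R)"
    by (simp add: card_Un_disjoint)
  then have "even (card (matched k R))"
    using card_matched_all(1)[OF k n] Q(2) by simp
  then obtain w where w: "block n R w"
    using block_matching[OF k, of R] by (auto simp: R_def)
  have "val n c (\<lambda>i j. y i j + w i j) = d" "val n c (\<lambda>i j. z i j + w i j) = d"
    by (rule const; unfold un(1); intro block_Un y z w un(2))+
  then show ?thesis
    by simp
qed

subsection \<open>Functionals that are constant on the cores\<close>

text \<open>If all perfect matchings on any four vertices have equal weight, the edge weights come
  from vertex weights. A triangle fixes the vertex weights, and the exchange identity propagates
  them.\<close>

lemma potential_exists:
  fixes g :: "nat \<Rightarrow> nat \<Rightarrow> real"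
  assumes sym: "\<And>a b. g a b = g b a"
    and exch: "\<And>a b e f. \<lbrakk>a \<in> V; b \<in> V; e \<in> V; f \<in> V; distinct [a, b, e, f]\<rbrakk>
      \<Longrightarrow> g a b + g e f = g a e + g b f"
    and V: "1 \<in> V" "2 \<in> V" "3 \<in> V"
  shows "\<exists>u. \<forall>a\<in>V. \<forall>b\<in>V. a \<noteq> b \<longrightarrow> g a b = u a + u b"
proof -
  \<comment> \<open>The solution for \<open>u 1\<close> of the three equations
    \<open>u a + u b = g a b\<close> on the triangle 1, 2, 3.\<close>
  define t where "t = (g 1 2 + g 1 3 - g 2 3) / 2"
  define u where "u a = (if a = 1 then t else g a 1 - t)" for a
  \<comment> \<open>The difference \<open>g a 2 - g a 1\<close> does not depend on \<open>a\<close>,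
    hence equals its value at \<open>a = 3\<close>.\<close>
  have g2: "g a 2 = g a 1 - g 1 3 + g 2 3" if "a \<in> V" "a \<notin> {1, 2}" for a
    using exch[of a 1 2 3] that V sym[of 3 2] by (cases "a = 3") (auto simp: sym[of 3] sym[of 2 1])
  have "g a b = u a + u b" if ab: "a \<in> V" "b \<in> V" "a \<noteq> b" for a b
  proof -
    consider "a = 1 \<or> b = 1" | "a \<noteq> 1" "b \<noteq> 1" "a = 2" | "a \<noteq> 1" "b \<noteq> 1" "b = 2"
      | "a \<notin> {1, 2}" "b \<notin> {1, 2}"
      by auto
    then show ?thesis
    proof cases
      case 1
      then show ?thesis
        using ab sym[of 1 b] by (auto simp: u_def)
    next
      case 2
      then show ?thesis
        using ab g2[of b]
          sym[of 2 b] sym[of 2 1] by (auto simp: u_def t_def field_simps)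
    next
      case 3
      then show ?thesis
        using ab g2[of a]
          sym[of 2 1] by (auto simp: u_def t_def field_simps)
    next
      case 4
      then have "g a b + g 1 2 = g a 1 + g b 2"
        using exch[of a b 1 2] ab V by auto
      then show ?thesis
        using 4 ab g2[of b] by (auto simp: u_def t_def field_simps)
    qed
  qed
  then show ?thesis
    by blast
qed

text \<open>The diagonal entries excluded below are those that vanish on all cores. The case $n = 5$ is
  separate because the exchange argument needs four indices.\<close>

lemma constant_functional:
  fixes c :: "nat \<Rightarrow> nat \<Rightarrow> real"
  assumes k: "n div 2 = k" and n: "n mod 4 \<noteq> 2" "n \<ge> 5"
    and const: "\<And>y. block n {1..(n + 1) div 2} y \<Longrightarrow> val n c y = d"
  shows "\<exists>u. (\<forall>a b. 1 \<le> a \<and> a \<le> (n + 1) div 2 \<and> 1 \<le> b \<and> b \<le> k \<and> a \<noteq> b \<longrightarrow> c a b = u a + u b) \<and>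
    (\<forall>i. 2 \<le> i \<and> i \<le> k \<and> (even n \<longrightarrow> i < k) \<longrightarrow> c i i = 2 * u i)"
proof -
  define l where "l = (n + 1) div 2"
  have l_eq: "Suc n div 2 = l"
    by (simp add: l_def)
  have val_l: "val n c (cells P N) = (\<Sum>(i, j)\<in>P. if j \<le> k then c i j else 0)
      - (\<Sum>(i, j)\<in>N. if j \<le> k then c i j else 0)"
    if "finite P" "finite N" "P \<union> N \<subseteq> {1..l} \<times> {1..}" for P N
    using val_cells[of P N n c] that unfolding k l_def by blast
  have nk: "even k \<and> n = 2 * k \<and> l = k \<or> even k \<and> n = 2 * k + 1 \<and> l = k + 1 \<or> odd k \<and> n = 2 * k + 1 \<and> l = k + 1"
    using k n unfolding l_def by presburger
  \<comment> \<open>The indices 1..v are those a perfect matching covers, so \<open>v\<close> is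
    even in every case.\<close>
  define v where "v = (if even k then k else k + 1)"
  have v: "v \<le> l" "k \<le> v" "k \<le> l" "even v"
    using nk by (auto simp: v_def)
  have nv: "n = 2 * k + 1" if "a \<le> v" "\<not> a \<le> k" for a
    using that nk by (auto simp: v_def split: if_splits)
  \<comment> \<open>The larger index comes first because k+1 is a row but not a column of the core.
    Accordingly \<open>e\<close> below orients its edge this way and adds the centre -1 when k+1 is
    an endpoint.\<close>
  define g where "g a b = c (max a b) (min a b)" for a b
  have g_sym: "g a b = g b a" for a b
    by (simp add: g_def max.commute min.commute)
  define e where "e a b = cells {(max a b, min a b)} (if max a b \<le> k then {} else {(k + 1, k + 1)})" for a b
  have e_sym: "e a b = e b a" for a b
    by (simp add: e_def max.commute min.commute)
  have e_less: "block n {a, b} (e a b) \<and> val n c (e a b) = g a b"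
    if "1 \<le> a" "a < b" "b \<le> v" for a b
  proof (cases "b \<le> k")
    case True
    then have "e a b = cells {(b, a)} {}" "g a b = c b a"
      using that by (auto simp: e_def g_def)
    moreover have "{(b, a)} \<union> {} \<subseteq> {1..l} \<times> {1..}"
      using that True v(3) by auto
    then have "val n c (cells {(b, a)} {}) = c b a"
      using that True by (subst val_l) auto
    ultimately show ?thesis
      using block_edge[OF k, of b a] that True by (simp add: insert_commute)
  next
    case False
    then have b: "b = k + 1"
      using that by (auto simp: v_def split: if_splits)
    then have "e a b = cells {(k + 1, a)} {(k + 1, k + 1)}" "g a b = c b a"
      using that by (auto simp: e_def g_def)
    then show ?thesis
      using block_middle_edge[OF nv[OF that(3) False], of a] that b v
      by (simp add: val_l)
  qed
  have e: "block n {a, b} (e a b)" "val n c (e a b) = g a b"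
    if "a \<noteq> b" "1 \<le> a" "a \<le> v" "1 \<le> b" "b \<le> v" for a b
    using e_less[of a b] e_less[of b a] that e_sym[of a b] g_sym[of a b]
    by (cases "a < b"; simp add: insert_commute)+
  have matched: "matched k Q = Q" if "Q \<subseteq> {1..v}" for Q
    using that by (auto simp: matched_def v_def)
  have exchange: "val n c y = val n c z"
    if "block n Q y" "block n Q z" "Q \<subseteq> {1..l}" "even (card (matched k Q))" for Q y z
    by (rule val_exchange[OF k n(1) const that(1,2) that(3)[unfolded l_def] that(4)])
  have e2: "block n {a, b, p, q} (\<lambda>i j. e a b i j + e p q i j)"
    if "distinct [a, b, p, q]" "{a, b, p, q} \<subseteq> {1..v}" for a b p q
    using block_Un[OF e(1)[of a b] e(1)[of p q]] that by (simp add: insert_commute)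
  have g_exch: "g a b + g p q = g a p + g b q"
    if "a \<in> {1..v}" "b \<in> {1..v}" "p \<in> {1..v}" "q \<in> {1..v}" "distinct [a, b, p, q]" for a b p q
  proof -
    have "val n c (\<lambda>i j. e a b i j + e p q i j) = val n c (\<lambda>i j. e a p i j + e b q i j)"
      using e2[of a b p q] e2[of a p b q] that v(1) matched[of "{a, b, p, q}"]
      by (intro exchange[of "{a, b, p, q}"]) (auto simp: insert_commute)
    then show ?thesis
      using e(2) that by simp
  qed
  \<comment> \<open>An edge may be entered in either orientation on the same two indices, so
    \<open>c\<close> is symmetric off the diagonal and \<open>g\<close> loses nothing.\<close>
  have flip: "c a b = c b a"
    if "a \<noteq> b" "1 \<le> a" "a \<le> k" "1 \<le> b" "b \<le> k" for a b
  proof -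
    have "val n c (cells {(a, b)} {}) = val n c (cells {(b, a)} {})"
      using block_edge[OF k, of a b] block_edge[OF k, of b a] that v matched[of "{a, b}"]
      by (intro exchange[of "{a, b}"]) (auto simp: insert_commute)
    then show ?thesis
      using that v by (simp add: val_l)
  qed
  \<comment> \<open>Compares the block with (k,k) = 1 to the edge {1,k} plus the centre. It needs
    only three indices, hence is available for k = 2.\<close>
  have last: "c k k - c (k + 1) k + c (k + 1) 1 = c k 1" if "even k" "n = 2 * k + 1"
  proof -
    have k2: "k \<ge> 2" "l = k + 1"
      using that n(2) nk by (presburger, auto)
    have "block n {1, k, k + 1} (\<lambda>i j. e 1 k i j + cells {(k + 1, k + 1)} {} i j)"
      using block_Un[OF e(1)[of 1 k] block_centre[OF that(2)]] v k2 by (simp add: insert_commute)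
    moreover have "matched k {1, k, k + 1} = {1, k}"
      using that k2 by (auto simp: matched_def)
    ultimately have "val n c (cells {(k, k), (k + 1, 1), (k + 1, k + 1)} {(k + 1, k)})
        = val n c (\<lambda>i j. e 1 k i j + cells {(k + 1, k + 1)} {} i j)"
      using block_last_positive[OF that(2), of 1] k2 by (intro exchange[of "{1, k, k + 1}"]) auto
    then show ?thesis
      using e(2)[of 1 k] v k2 by (simp add: val_l g_def)
  qed
  show ?thesis
  proof (cases "n = 5")
    case True
    then have [simp]: "k = 2" "l = 3"
      using k by (auto simp: l_def)
    \<comment> \<open>The equations for c(2,2), c(2,1) and c(3,2) force these values; the one for
      c(3,1) is then exactly \<open>last\<close>.\<close>
    define u where "u i = (if i = 1 then c 2 1 - c 2 2 / 2 else if i = 2 then c 2 2 / 2 else c 3 2 - c 2 2 / 2)"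
      for i :: nat
    have "c a b = u a + u b"
      if "1 \<le> a" "a \<le> l" "1 \<le> b" "b \<le> k" "a \<noteq> b" for a b
    proof -
      have "(a = 1 \<and> b = 2) \<or> (a = 2 \<and> b = 1) \<or> (a = 3 \<and> b = 1) \<or> (a = 3 \<and> b = 2)"
        using that by auto
      then show ?thesis
        using last True flip[of 1 2] by (auto simp: u_def)
    qed
    moreover have "c i i = 2 * u i" if "2 \<le> i" "i \<le> k" for i
      using that by (simp add: u_def)
    ultimately show ?thesis
      unfolding l_def[symmetric] by blast
  next
    case False
    then have v4: "v \<ge> 4" "k \<ge> 3"
      using nk n v by (auto simp: v_def)
    obtain u0 where u0: "g a b = u0 a + u0 b"
      if "a \<in> {1..v}" "b \<in> {1..v}" "a \<noteq> b" for a b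
      using potential_exists[of g "{1..v}", OF g_sym g_exch] v4 by auto
    have c0: "c a b = u0 a + u0 b"
      if "a \<noteq> b" "1 \<le> a" "a \<le> v" "1 \<le> b" "b \<le> k" for a b
    proof (cases "b < a")
      case True
      then show ?thesis
        using u0[of a b] that v by (simp add: g_def)
    next
      case False
      then show ?thesis
        using u0[of a b] that v flip[of a b] by (simp add: g_def)
    qed
    \<comment> \<open>The choice a = 1, j = k in the diagonal blocks suits every i strictly between.
      The fourth index contributes the same edge weight on both sides and cancels.\<close>
    have diag: "c i i = 2 * u0 i" if "2 \<le> i" "i < k" for i
    proof (cases "even k")
      case True
      then have "k \<ge> 4"
        using v4 by (auto simp: v_def)
      \<comment> \<open>Any index outside 1, i, k; one of 2 and 3 will do since k is at least
        4.\<close>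
      define m where "m = (if i = 2 then 3 else 2 :: nat)"
      have m: "m \<noteq> 1" "m \<noteq> i" "m \<noteq> k" "1 \<le> m" "m \<le> k" "i \<noteq> k" "1 < i"
        using \<open>k \<ge> 4\<close> that by (auto simp: m_def)
      have "val n c (cells {(i, i), (1, k), (k, m)} {(i, k)}) = val n c (\<lambda>p q. e 1 i p q + e k m p q)"
        using block_diagonal[OF k, of 1 i k m] e2[of 1 i k m] matched[of "{1, i, k, m}"] m that v
        by (intro exchange[of "{1, i, k, m}"]) auto
      then have "c i i + c 1 k + c k m - c i k = c i 1 + c k m"
        using e(2)[of 1 i] e(2)[of k m] m that v by (simp add: val_l g_def max_def min_def)
      then show ?thesis
        using c0[of 1 k] c0[of i k] c0[of i 1] that v by simp
    next
      case False
      then have nk': "n = 2 * k + 1" "v = k + 1"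
        using nk by (auto simp: v_def)
      have "val n c (cells {(i, i), (1, k), (k + 1, k)} {(i, k), (k + 1, k + 1)})
          = val n c (\<lambda>p q. e 1 i p q + e k (k + 1) p q)"
        using block_diagonal_middle[OF nk'(1), of 1 i k] e2[of 1 i k "k + 1"] matched[of "{1, i, k, k + 1}"]
          that v nk' by (intro exchange[of "{1, i, k, k + 1}"]) auto
      then have "c i i + c 1 k + c (k + 1) k - c i k = c i 1 + c (k + 1) k"
        using e(2)[of 1 i] e(2)[of k "k + 1"] that v nk'(2) by (simp add: val_l g_def)
      then show ?thesis
        using c0[of 1 k] c0[of i k] c0[of i 1] that v by simp
    qed
    consider "even k" "n = 2 * k" "l = k" | "odd k" "n = 2 * k + 1" "l = k + 1"
      | "even k" "n = 2 * k + 1" "l = k + 1"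
      using nk by auto
    then show ?thesis
    proof cases
      case 1
      then show ?thesis
        using c0 diag by (intro exI[of _ u0]) (simp add: l_eq v_def)
    next
      case 2
      \<comment> \<open>The two ones of row k besides the middle column come from the edges to 1 and
        2; the weight of (k+1,k) occurs on both sides.\<close>
      have "val n c (cells {(k, 1), (2, k), (k + 1, k)} {(k, k), (k + 1, k + 1)})
          = val n c (\<lambda>p q. e 1 2 p q + e k (k + 1) p q)"
        using block_last_negative[OF 2(2), of 1 2] e2[of 1 2 k "k + 1"] matched[of "{1, 2, k, k + 1}"] 2 v4 v
        by (intro exchange[of "{1, 2, k, k + 1}"]) (auto simp: v_def)
      then have "c k 1 + c 2 k + c (k + 1) k - c k k = c 2 1 + c (k + 1) k"
        using e(2)[of 1 2] e(2)[of k "k + 1"] v4 v 2(1,3)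
        by (simp add: val_l g_def v_def numeral_2_eq_2[symmetric])
      then have "c k k = 2 * u0 k"
        using c0[of k 1] c0[of 2 k] c0[of 2 1] v4 v by simp
      then have "c i i = 2 * u0 i" if "2 \<le> i" "i \<le> k" for i
        using diag[of i] that by (cases "i = k") auto
      then show ?thesis
        using c0 2 by (intro exI[of _ u0]) (simp add: l_eq v_def)
    next
      case 3
      then have k4: "k \<ge> 4" "v = k"
        using v4 by (auto simp: v_def)
      \<comment> \<open>The exchanges among 1..k say nothing about \<open>u0\<close> at k+1. Its
        value is chosen to fit column 1 of the middle row, and \<open>block_middle\<close> transfers
        this to the other columns.\<close>
      define u where "u = u0(k + 1 := c (k + 1) 1 - u0 1)"
      have u: "u i = u0 i" if "i \<le> k" for i
        using that by (simp add: u_def)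
      have mid: "c (k + 1) j = u (k + 1) + u j" if j: "2 \<le> j" "j \<le> k" for j
      proof -
        \<comment> \<open>Together with \<open>b\<close>, two distinct indices among 2, 3, 4 that
          differ from \<open>j\<close>. The base column is 1 because \<open>block_middle\<close>
          requires \<open>a < j\<close>.\<close>
        define m where "m = (if j = 2 then 3 else 2 :: nat)"
        define b where "b = (if j = 2 \<or> j = 3 then 4 else 3 :: nat)"
        have mb: "1 \<noteq> j" "m \<noteq> 1" "b \<noteq> 1" "m \<noteq> j" "b \<noteq> j" "b \<noteq> m" "1 \<le> m" "m \<le> k" "1 \<le> b" "b \<le> k"
          using j k4 by (auto simp: m_def b_def)
        have "block n {1, m, b, j, k + 1} (\<lambda>p q. (e 1 m p q + e b j p q) + cells {(k + 1, k + 1)} {} p q)"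
          using block_Un[OF e2[of 1 m b j] block_centre[OF 3(2)]] mb j k4
          by (simp add: insert_commute)
        moreover have "matched k {1, m, b, j, k + 1} = {1, m, b, j}"
          using 3 mb j by (auto simp: matched_def)
        moreover have "card {1, m, b, j} = 4"
          using mb by auto
        ultimately have "val n c (cells {(k + 1, 1), (j, m), (b, j), (k + 1, k + 1)} {(k + 1, j)})
            = val n c (\<lambda>p q. (e 1 m p q + e b j p q) + cells {(k + 1, k + 1)} {} p q)"
          using block_middle[OF 3(2), of 1 j b m] mb j 3
          by (intro exchange[of "{1, m, b, j, k + 1}"]) auto
        then have "c (k + 1) 1 + c j m + c b j - c (k + 1) j = g 1 m + g b j"
          using e(2)[of 1 m] e(2)[of b j] mb j k4 3(3) by (simp add: val_l)
        then show ?thesis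
          using u0[of 1 m] u0[of b j] c0[of j m] c0[of b j] mb j k4 by (simp add: u_def)
      qed
      have "c (k + 1) 1 = u (k + 1) + u 1"
        using k4 by (simp add: u_def)
      with mid have mid: "c (k + 1) j = u (k + 1) + u j" if "1 \<le> j" "j \<le> k" for j
        using that by (cases "j = 1") auto
      have "c a b = u a + u b"
        if "1 \<le> a" "a \<le> l" "1 \<le> b" "b \<le> k" "a \<noteq> b" for a b
        using that c0[of a b] mid[of b] 3 k4 by (cases "a = k + 1") (auto simp: u)
      moreover have "c k k = 2 * u k"
        using last[OF 3(1,2)] mid[of k] mid[of 1] c0[of k 1] k4 by (simp add: u)
      then have "c i i = 2 * u i" if "2 \<le> i" "i \<le> k" for i
        using that diag[of i] by (cases "i = k") (auto simp: u)
      ultimately show ?thesis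
        unfolding l_def[symmetric] by blast
    qed
  qed
qed

subsection \<open>Affine hull and dimension\<close>

lemma rho_linear [simp]:
  "rho n i (X + Y) = rho n i X + rho n i Y" "rho n i (r *\<^sub>R X) = r * rho n i X"
  "rho_mid n (X + Y) = rho_mid n X + rho_mid n Y" "rho_mid n (r *\<^sub>R X) = r * rho_mid n X"
  by (simp_all add: rho_def rho_mid_def Let_def sum.distrib sum_distrib_left distrib_left)

lemma unfold_core_linear:
  "unfold_core n (\<lambda>i j. y i j + z i j) i j = unfold_core n y i j + unfold_core n z i j"
  "unfold_core n (\<lambda>i j. r * y i j) i j = r * unfold_core n y i j"
proof -
  have "row n (\<lambda>i j. y i j + z i j) i j = row n y i j + row n z i j"
    "row n (\<lambda>i j. r * y i j) i j = r * row n y i j" for i j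
    by (simp_all add: row_def)
  then show "unfold_core n (\<lambda>i j. y i j + z i j) i j = unfold_core n y i j + unfold_core n z i j"
    "unfold_core n (\<lambda>i j. r * y i j) i j = r * unfold_core n y i j"
    by (simp_all add: unfold_core_def)
qed

text \<open>Up to entries that are zero on the affine space, the functional is the sum of the
  \<open>u i\<close> times \<open>rho n i\<close>, plus \<open>u (k + 1)\<close> times
  \<open>rho_mid\<close> for odd n. The prescribed values 1, and 0 or 1 by the parity of k, select
  exactly the matched indices, so the result is the weight of a perfect matching.\<close>

lemma val_core_affine_space:
  fixes Y :: "real ^ 'k::{finite,linorder} ^ 'l::{finite,linorder}"
  assumes k: "n div 2 = k" and n: "n mod 4 \<noteq> 2" and l: "CARD('l) = (n + 1) div 2"
    and Y: "Y \<in> core_affine_space n"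
    and off: "\<And>a b. \<lbrakk>1 \<le> a; a \<le> (n + 1) div 2; 1 \<le> b; b \<le> k; a \<noteq> b\<rbrakk> \<Longrightarrow> c a b = u a + u b"
    and diag: "\<And>i. \<lbrakk>2 \<le> i; i \<le> k; even n \<longrightarrow> i < k\<rbrakk> \<Longrightarrow> c i i = 2 * u i"
  shows "val n c (entry Y) = sum u (matched k {1..(n + 1) div 2})"
proof -
  define l where "l = (n + 1) div 2"
  have rho: "rho n i Y = 1" if "1 \<le> i" "i \<le> k" for i
    using Y that k by (auto simp: core_affine_space_def Let_def split: if_splits)
  have zero: "entry Y 1 1 = 0" "even n \<Longrightarrow> entry Y k k = 0"
    using Y k by (auto simp: core_affine_space_def Let_def split: if_splits)
  have mid: "(\<Sum>j = 1..k. entry Y (k + 1) j) = (if odd k then 1 else 0)" if "odd n"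
    using Y k that by (auto simp: core_affine_space_def Let_def rho_mid_def split: if_splits)
  have "val n c (entry Y) = (\<Sum>i = 1..l. \<Sum>j = 1..k. (u i + u j) * entry Y i j)"
    unfolding val_def k l_def[symmetric]
  proof (intro sum.cong refl)
    fix i j
    assume ij: "i \<in> {1..l}" "j \<in> {1..k}"
    consider "i \<noteq> j" | "i = j" "i = 1" | "i = j" "i = k" "even n" | "i = j" "2 \<le> i" "even n \<longrightarrow> i < k"
      using ij by force
    then show "c i j * entry Y i j = (u i + u j) * entry Y i j"
      using ij off[of i j] diag[of i] zero by cases (auto simp: l_def)
  qed
  also have "\<dots> = (\<Sum>i = 1..l. u i * (\<Sum>j = 1..k. entry Y i j)) + (\<Sum>i = 1..l. \<Sum>j = 1..k. u j * entry Y i j)"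
    by (simp add: distrib_right sum.distrib sum_distrib_left)
  also have "(\<Sum>i = 1..l. \<Sum>j = 1..k. u j * entry Y i j) = (\<Sum>j = 1..k. u j * (\<Sum>i = 1..l. entry Y i j))"
    by (subst sum.swap) (simp add: sum_distrib_left)
  also have "(\<Sum>i = 1..l. u i * (\<Sum>j = 1..k. entry Y i j)) = (\<Sum>i = 1..k. u i * (\<Sum>j = 1..k. entry Y i j))
      + (if odd n then u (k + 1) * (\<Sum>j = 1..k. entry Y (k + 1) j) else 0)"
  proof -
    have "l = (if odd n then k + 1 else k)"
      using k unfolding l_def by presburger
    then show ?thesis
      by simp
  qed
  finally have "val n c (entry Y) = (\<Sum>i = 1..k. u i * rho n i Y)
      + (if odd n then u (k + 1) * (\<Sum>j = 1..k. entry Y (k + 1) j) else 0)"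
    unfolding rho_eq[OF l] k l_def[symmetric] by (simp add: distrib_left sum.distrib)
  moreover have "odd n" if odd: "odd k"
  proof
    assume "even n"
    then have "n = 2 * k"
      using k by auto
    moreover obtain m where "k = 2 * m + 1"
      using odd by (elim oddE)
    ultimately have "n = 4 * m + 2"
      by simp
    then show False
      using n by presburger
  qed
  ultimately have "val n c (entry Y) = sum u {1..if even k then k else k + 1}"
    using mid by (simp add: rho)
  then show ?thesis
    using card_matched_all(2)[OF k n] by simp
qed

lemma affine_hull_core:
  fixes n :: nat
  assumes "n \<ge> 5" and n: "n mod 4 \<noteq> 2"
    and card: "CARD('n::{finite,linorder}) = n" "CARD('k::{finite,linorder}) = n div 2"
      "CARD('l::{finite,linorder}) = (n + 1) div 2"
  shows "affine hull (core ` {X :: real ^ 'n::{finite,linorder} ^ 'n::{finite,linorder}. is_QTSASM X})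
      = (core_affine_space n :: (real ^ 'k::{finite,linorder} ^ 'l::{finite,linorder}) set)"
    (is "affine hull ?S = ?A")
proof
  have "affine ?A"
    unfolding affine_def core_affine_space_def Let_def by (auto simp flip: distrib_right)
  then show "affine hull ?S \<subseteq> ?A"
    using core_QTSASM_mem[OF _ _ card] \<open>n \<ge> 5\<close> by (intro hull_minimal) auto
  show "?A \<subseteq> affine hull ?S"
  proof
    fix Y
    assume Y: "Y \<in> ?A"
    obtain F where F: "affine hull ?S = \<Inter>F" "\<And>h. h \<in> F \<Longrightarrow> \<exists>a b. a \<noteq> 0 \<and> h = {x. a \<bullet> x = b}"
      using affine_hull_finite_intersection_hyperplanes[of ?S] by metis
    have "Y \<in> h" if "h \<in> F" for h
    proof -
      obtain a b where h: "h = {x. a \<bullet> x = b}"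
        using F(2) \<open>h \<in> F\<close> by blast
      let ?c = "entry a"
      have const: "val n ?c y = b" if "block n {1..(n + 1) div 2} y" for y
      proof -
        have "(mat_of y :: real ^ 'k::{finite,linorder} ^ 'l::{finite,linorder}) \<in> ?S"
          using block_QTSASM[OF that card(1)] core_unfold_core[OF card, of y]
          by (metis imageI mem_Collect_eq)
        then have "a \<bullet> mat_of y = b"
          using hull_subset[of ?S affine] F(1) \<open>h \<in> F\<close> h by blast
        moreover have "a \<bullet> mat_of y = val n ?c y"
          unfolding inner_entry val_def card by (intro sum.cong refl) (simp add: card)
        ultimately show ?thesis
          by simp
      qed
      obtain u where u:
        "\<And>p q. \<lbrakk>1 \<le> p; p \<le> (n + 1) div 2; 1 \<le> q; q \<le> n div 2; p \<noteq> q\<rbrakk> \<Longrightarrow> ?c p q = u p + u q"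
        "\<And>i. \<lbrakk>2 \<le> i; i \<le> n div 2; even n \<longrightarrow> i < n div 2\<rbrakk> \<Longrightarrow> ?c i i = 2 * u i"
        using constant_functional[OF refl n \<open>n \<ge> 5\<close> const] by metis
      \<comment> \<open>Evaluating the functional on a perfect matching identifies the hyperplane's
        constant \<open>b\<close> with the sum of \<open>u\<close> that it takes at
        \<open>Y\<close>.\<close>
      obtain w where w: "block n {1..(n + 1) div 2} w"
        "val n ?c w = sum u (matched (n div 2) {1..(n + 1) div 2})"
        using block_matching[OF refl subset_refl card_matched_all(1)[OF refl n]] u(1)
        by (metis atLeastAtMost_iff)
      have "a \<bullet> Y = val n ?c (entry Y)"
        unfolding inner_entry val_def card ..
      also have "\<dots> = b"
        using val_core_affine_space[OF refl n card(3) Y, of ?c u] u w const by simp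
      finally show ?thesis
        by (simp add: h)
    qed
    then show "Y \<in> affine hull ?S"
      by (simp add: F(1))
  qed
qed

section \<open>Dimension of the affine space and of the polytope\<close>

lemma aff_dim_linear_fibre:
  fixes T :: "'a::euclidean_space \<Rightarrow> 'b::euclidean_space"
  assumes T: "linear T" and inj: "\<And>z. (\<And>x. T x \<bullet> z = 0) \<Longrightarrow> z = 0" and t: "T x0 = t"
  shows "aff_dim {x. T x = t} = int DIM('a) - int DIM('b)"
proof -
  have adj: "linear (adjoint T)" "\<And>x z. x \<bullet> adjoint T z = T x \<bullet> z"
    using T by (simp_all add: adjoint_linear adjoint_works)
  \<comment> \<open>The assumption on \<open>z\<close> says that the components of \<open>T\<close>
    are linearly independent, that is, the adjoint is injective. The kernel of \<open>T\<close> is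
    the orthogonal complement of the adjoint's range.\<close>
  have "inj (adjoint T)"
    unfolding linear_injective_0[OF adj(1)] using adj(2) inj by (metis inner_zero_right)
  then have "dim (range (adjoint T)) = DIM('b)"
    using dim_image_eq[OF adj(1), of UNIV] by simp
  moreover have "{x \<in> UNIV. \<forall>y \<in> range (adjoint T). orthogonal y x} = {x. T x = 0}"
    by (auto simp: orthogonal_def inner_commute[of "adjoint T _"] adj(2) dest: spec[of _ "T _"])
  ultimately have "dim {x. T x = 0} + DIM('b) = DIM('a)"
    using dim_subspace_orthogonal_to_vectors[of "range (adjoint T)" UNIV]
      linear_subspace_image[OF adj(1) subspace_UNIV] by simp
  moreover have "{x. T x = t} = (+) x0 ` {x. T x = 0}"
  proof (intro set_eqI iffI)
    fix x
    assume "x \<in> {x. T x = t}"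
    then have "x = x0 + (x - x0)" "T (x - x0) = 0"
      using t by (simp_all add: linear_diff[OF T])
    then show "x \<in> (+) x0 ` {x. T x = 0}"
      by blast
  qed (auto simp: linear_add[OF T] t)
  moreover have "aff_dim {x. T x = 0} = int (dim {x. T x = 0})"
    by (intro aff_dim_subspace linear_subspace_kernel T)
  ultimately show ?thesis
    by (simp add: aff_dim_translation_eq)
qed

text \<open>The k + 2 defining equations are linearly independent: a vanishing combination of the
  functionals is tested on the unit matrices \<open>E p q\<close>.\<close>

lemma aff_dim_core_affine_space:
  fixes n :: nat
  assumes "n \<ge> 5" and n: "n mod 4 \<noteq> 2"
    and card: "CARD('k::{finite,linorder}) = n div 2" "CARD('l::{finite,linorder}) = (n + 1) div 2"
    and Y0: "Y0 \<in> (core_affine_space n :: (real ^ 'k::{finite,linorder} ^ 'l::{finite,linorder}) set)"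
  shows "aff_dim (core_affine_space n :: (real ^ 'k::{finite,linorder} ^ 'l::{finite,linorder}) set)
    = int ((n + 1) div 2 * (n div 2)) - int (n div 2 + 2)"
proof -
  define k where "k = n div 2"
  define l where "l = (n + 1) div 2"
  have kl: "even n \<and> l = k \<and> k \<ge> 4 \<or> odd n \<and> l = k + 1 \<and> k \<ge> 2"
    using n \<open>n \<ge> 5\<close> unfolding k_def l_def by presburger
  define last where "last Y = (if even n then entry Y k k else rho_mid n Y)"
    for Y :: "real ^ 'k::{finite,linorder} ^ 'l::{finite,linorder}"
  define T :: "real ^ 'k::{finite,linorder} ^ 'l::{finite,linorder} \<Rightarrow> (real ^ 'k::{finite,linorder}) \<times> real \<times> real"
    where "T Y = (\<chi> a. rho n (pos a) Y, entry Y 1 1, last Y)" for Y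
  define t :: "(real ^ 'k::{finite,linorder}) \<times> real \<times> real"
    where "t = (\<chi> a. 1, 0, if odd n \<and> odd k then 1 else 0)"
  have T: "linear T"
    by (rule linearI) (auto simp: T_def last_def vec_eq_iff)
  have fibre: "core_affine_space n = {Y. T Y = t}"
  proof -
    have "(\<forall>i\<in>{1..k}. rho n i Y = 1) \<longleftrightarrow> (\<forall>a :: 'k::{finite,linorder}. rho n (pos a) Y = 1)"
      for Y :: "real ^ 'k::{finite,linorder} ^ 'l::{finite,linorder}"
      using bij_betw_imp_surj_on[OF bij_betw_pos[where 'a = 'k]] card(1) unfolding k_def
      by (metis (no_types, lifting) rangeE rangeI)
    then show ?thesis
      by (auto simp: core_affine_space_def Let_def T_def t_def last_def vec_eq_iff k_def)
  qed
  have "z = 0" if z: "\<And>Y. T Y \<bullet> z = 0" for z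
  proof -
    obtain p \<mu> \<nu> where z_eq: "z = (p, \<mu>, \<nu>)"
      by (metis surj_pair)
    define f where "f i = p $ idx i" for i
    have eq: "(\<Sum>i = 1..k. f i * rho n i Y) + \<mu> * entry Y 1 1 + \<nu> * last Y = 0" for Y
    proof -
      have "(\<Sum>i = 1..k. f i * rho n i Y) = (\<chi> a. rho n (pos a) Y) \<bullet> p"
        using sum_pos[of "\<lambda>i. f i * rho n i Y", where 'a = 'k] card(1)
        by (simp add: inner_vec_def f_def k_def mult.commute)
      then show ?thesis
        using z[of Y] by (simp add: T_def z_eq inner_Pair mult.commute add.assoc)
    qed
    define E :: "nat \<Rightarrow> nat \<Rightarrow> real ^ 'k::{finite,linorder} ^ 'l::{finite,linorder}"
      where "E p q = mat_of (\<lambda>i j. if i = p then if j = q then 1 else 0 else 0)" for p q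
    have E: "entry (E p q) i j = (if i = p then if j = q then 1 else 0 else 0)"
      if "1 \<le> i" "i \<le> l" "1 \<le> j" "j \<le> k" for p q i j
      using that by (simp add: E_def card k_def l_def)
    have rho: "rho n i (E p q) = (if i = p then 1 else 0) + (if i = q then 1 else 0)"
      if "1 \<le> i" "i \<le> k" "1 \<le> p" "p \<le> l" "1 \<le> q" "q \<le> k" for i p q
    proof -
      have "(\<Sum>j = 1..k. entry (E p q) i j) = (\<Sum>j = 1..k. if j = q then if i = p then 1 else 0 else 0)"
        using that kl by (intro sum.cong refl) (auto simp: E)
      moreover have "(\<Sum>j = 1..l. entry (E p q) j i) = (\<Sum>j = 1..l. if j = p then if i = q then 1 else 0 else 0)"
        using that kl by (intro sum.cong refl) (auto simp: E)
      ultimately show ?thesis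
        using that unfolding rho_eq[OF card(2)] k_def[symmetric] l_def[symmetric] by simp
    qed
    have sum: "(\<Sum>i = 1..k. f i * rho n i (E p q)) = (if p \<le> k then f p else 0) + f q"
      if "1 \<le> p" "p \<le> l" "1 \<le> q" "q \<le> k" for p q
    proof -
      have "(\<Sum>i = 1..k. f i * rho n i (E p q)) = (\<Sum>i = 1..k. (if i = p then f p else 0) + (if i = q then f q else 0))"
        using that by (intro sum.cong refl) (auto simp: rho)
      then show ?thesis
        using that by (simp add: sum.distrib)
    qed
    have last: "last (E p q) = (if (if even n then p = k \<and> q = k else p = k + 1) then 1 else 0)"
      if "1 \<le> p" "p \<le> l" "1 \<le> q" "q \<le> k" for p q
    proof (cases "even n")
      case True
      then show ?thesis
        using that kl by (simp add: last_def E)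
    next
      case False
      have "(\<Sum>j = 1..k. entry (E p q) (k + 1) j) = (\<Sum>j = 1..k. if j = q then if p = k + 1 then 1 else 0 else 0)"
        using that kl False by (intro sum.cong refl) (auto simp: E)
      then show ?thesis
        using that False by (simp add: last_def rho_mid_def Let_def flip: k_def)
    qed
    have main: "(if p \<le> k then f p else 0) + f q + \<mu> * (if p = 1 \<and> q = 1 then 1 else 0)
        + \<nu> * (if (if even n then p = k \<and> q = k else p = k + 1) then 1 else 0) = 0"
      if "1 \<le> p" "p \<le> l" "1 \<le> q" "q \<le> k" for p q
    proof -
      have "entry (E p q) 1 1 = (if p = 1 \<and> q = 1 then 1 else 0)"
        using kl by (subst E) auto
      then show ?thesis
        using eq[of "E p q"] unfolding sum[OF that] last[OF that] by simp
    qed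
    \<comment> \<open>The cell (2,2) lies in \<open>rho n 2\<close> twice and in no other
      functional: for even n because k is at least 4, for odd n because k + 1 exceeds 2. Column 2
      then yields the other \<open>f i\<close>, the corner yields \<open>\<mu>\<close>, and (k,k) or
      (k+1,1) yields \<open>\<nu>\<close>.\<close>
    have "f 2 = 0"
      using main[of 2 2] kl by auto
    then have f: "f i = 0" if "1 \<le> i" "i \<le> k" for i
      using main[of i 2] kl that by (cases "i = 2") auto
    have "\<mu> = 0"
      using main[of 1 1] kl f[of 1] by auto
    moreover have "\<nu> = 0"
      using main[of k k] main[of "k + 1" 1] kl f[of k] f[of 1] by auto
    moreover have "p = 0"
    proof -
      have "p $ a = f (pos a)" for a
        by (simp add: f_def)
      then show ?thesis
        using f pos_range[where 'a = 'k] card(1) by (simp add: vec_eq_iff k_def)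
    qed
    ultimately show ?thesis
      by (simp add: z_eq zero_prod_def)
  qed
  then have "aff_dim {Y. T Y = t} = int DIM(real ^ 'k::{finite,linorder} ^ 'l::{finite,linorder})
      - int DIM((real ^ 'k::{finite,linorder}) \<times> real \<times> real)"
    using Y0 fibre by (intro aff_dim_linear_fibre[OF T, of Y0]) auto
  then show ?thesis
    unfolding fibre by (simp add: card)
qed

text \<open>The linear extension map recovers the centre from \<open>\<rho>\<^sub>1 = 1\<close>, which makes it homogeneous.\<close>

lemma aff_dim_core_image:
  fixes n :: nat
  assumes "n \<ge> 2" and card: "CARD('n::{finite,linorder}) = n" "CARD('k::{finite,linorder}) = n div 2"
      "CARD('l::{finite,linorder}) = (n + 1) div 2"
  shows "aff_dim (core ` {X :: real ^ 'n::{finite,linorder} ^ 'n::{finite,linorder}. is_QTSASM X}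
        :: (real ^ 'k::{finite,linorder} ^ 'l::{finite,linorder}) set)
      = aff_dim {X :: real ^ 'n::{finite,linorder} ^ 'n::{finite,linorder}. is_QTSASM X}"
    (is "aff_dim ?C = aff_dim ?S")
proof (rule antisym)
  have "linear (core :: real ^ 'n::{finite,linorder} ^ 'n::{finite,linorder}
      \<Rightarrow> real ^ 'k::{finite,linorder} ^ 'l::{finite,linorder})"
    by (rule linearI) (simp_all add: core_def vec_eq_iff)
  then show "aff_dim ?C \<le> aff_dim ?S"
    by (rule aff_dim_linear_image_le)
  \<comment> \<open>The middle row is symmetric about the centre, so the centre is 1 minus twice
    \<open>rho_mid\<close>; the constant 1 is written as \<open>rho n 1 Y\<close>.\<close>
  define y where "y Y i j = (if j \<le> n div 2 then entry Y i j else rho n 1 Y - 2 * rho_mid n Y)"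
    for Y :: "real ^ 'k::{finite,linorder} ^ 'l::{finite,linorder}" and i j
  define G :: "real ^ 'k::{finite,linorder} ^ 'l::{finite,linorder}
      \<Rightarrow> real ^ 'n::{finite,linorder} ^ 'n::{finite,linorder}"
    where "G Y = mat_of (unfold_core n (y Y))" for Y
  have "linear G"
  proof (rule linearI)
    fix Y Z and r
    have "y (Y + Z) = (\<lambda>i j. y Y i j + y Z i j)" "y (r *\<^sub>R Y) = (\<lambda>i j. r * y Y i j)"
      by (auto simp: y_def fun_eq_iff algebra_simps)
    then show "G (Y + Z) = G Y + G Z" "G (r *\<^sub>R Y) = r *\<^sub>R G Y"
      by (simp_all add: G_def mat_of_def vec_eq_iff unfold_core_linear)
  qed
  moreover have "G (core X) = X" if X: "is_QTSASM X" for X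
  proof -
    let ?Y = "core X :: real ^ 'k::{finite,linorder} ^ 'l::{finite,linorder}"
    note turn = QTSASM_turn[OF X, unfolded card]
    have Y: "y ?Y i j = entry X i j"
      if "1 \<le> i" "i \<le> (n + 1) div 2" "1 \<le> j" "j \<le> n div 2" for i j
      using that by (simp add: y_def entry_core card)
    have mem: "?Y \<in> core_affine_space n"
      by (rule core_QTSASM_mem[OF X \<open>n \<ge> 2\<close> card])
    have half: "entry X i j = entry X (n + 1 - i) (n + 1 - j)"
      if "1 \<le> i" "i \<le> n" "1 \<le> j" "j \<le> n" for i j
    proof -
      have "entry X i j = entry X (n + 1 - j) i"
        using that by (intro turn) auto
      also have "\<dots> = entry X (n + 1 - i) (n + 1 - j)"
        using that by (intro turn) auto
      finally show ?thesis .
    qed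
    have centre: "y ?Y i j = entry X i j" if "odd n" "i = n div 2 + 1" "j = n div 2 + 1" for i j
    proof -
      define k where "k = n div 2"
      have k: "n = 2 * k + 1" "(n + 1) div 2 = k + 1"
        using that(1) by (auto simp: k_def elim!: oddE)
      have "entry X q (k + 1) = entry X (k + 1) q" if "1 \<le> q" "q \<le> k" for q
        using turn[of q "k + 1"] that k(1) by simp
      then have "(\<Sum>q = 1..k + 1. entry X q (k + 1)) = (\<Sum>q = 1..k. entry X (k + 1) q) + entry X (k + 1) (k + 1)"
        by simp
      moreover have "(\<Sum>q = 1..n. entry X (k + 1) q) = 1"
        using QTSASM_row_sums(1)[OF X, of "k + 1"] k card(1) by simp
      ultimately have "entry X (k + 1) (k + 1) = 1 - 2 * (\<Sum>q = 1..k. entry X (k + 1) q)"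
        using QTSASM_row_split[OF X card(1), of "k + 1", unfolded k(2) k_def[symmetric]] k(1)
        by simp
      moreover have "rho_mid n ?Y = (\<Sum>q = 1..k. entry X (k + 1) q)"
        unfolding rho_mid_def Let_def k_def[symmetric] using card[folded k_def, unfolded k(2)]
        by (intro sum.cong refl) (simp add: entry_core)
      moreover have "rho n 1 ?Y = 1"
        using mem \<open>n \<ge> 2\<close>
        by (auto simp: core_affine_space_def Let_def split: if_splits)
      ultimately show ?thesis
        using that(2,3) by (simp add: y_def k_def)
    qed
    have row: "row n (y ?Y) i j = entry X i j"
      if "1 \<le> i" "i \<le> (n + 1) div 2" "1 \<le> j" "j \<le> n" for i j
    proof -
      have "i \<le> n div 2 \<or> odd n \<and> i = n div 2 + 1"
        using that(1,2) by presburger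
      then consider "j \<le> n div 2" | "j > n div 2" "i \<le> n div 2"
        | "odd n" "i = n div 2 + 1" "j = n div 2 + 1" | "odd n" "i = n div 2 + 1" "j > n div 2 + 1"
        by fastforce
      then show ?thesis
      proof cases
        case 1
        then show ?thesis
          using that Y by (simp only: row_def if_True)
      next
        case 2
        then have "entry X i j = entry X (n + 1 - j) i"
          using that by (intro turn) auto
        moreover have "y ?Y (n + 1 - j) i = entry X (n + 1 - j) i"
          using 2 that by (intro Y) auto
        ultimately show ?thesis
          using 2 unfolding row_def by (simp only: not_le[symmetric] if_True if_False)
      next
        case 3
        then have "n + 1 - j = n div 2 + 1"
          by (auto elim!: oddE)
        then show ?thesis
          using 3 centre by (simp add: row_def)
      next
        case 4
        then have "n + 1 - i = i"
          by (auto elim!: oddE)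
        then have "entry X i j = entry X i (n + 1 - j)"
          using half[of i j] that by simp
        moreover have "y ?Y i (n + 1 - j) = entry X i (n + 1 - j)"
          using 4 that by (intro Y) auto
        moreover have "\<not> j \<le> n div 2" "\<not> i \<le> n div 2"
          using 4 by simp_all
        ultimately show ?thesis
          unfolding row_def by (simp only: if_False)
      qed
    qed
    have "unfold_core n (y ?Y) i j = entry X i j"
      if "1 \<le> i" "i \<le> n" "1 \<le> j" "j \<le> n" for i j
    proof (cases "i \<le> (n + 1) div 2")
      case True
      then show ?thesis
        using row that by (simp add: unfold_core_def)
    next
      case False
      then have "row n (y ?Y) (n + 1 - i) (n + 1 - j) = entry X (n + 1 - i) (n + 1 - j)"
        using that by (intro row) auto
      then show ?thesis
        using False half[OF that] by (simp add: unfold_core_def)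
    qed
    then show ?thesis
      by (intro mat_eqI) (simp add: G_def card)
  qed
  then have "?S = G ` ?C"
    by (force simp: image_image)
  ultimately show "aff_dim ?S \<le> aff_dim ?C"
    using aff_dim_linear_image_le by metis
qed

theorem theorem6p11:
  fixes n :: nat
  assumes "n \<ge> 5" and "n mod 4 \<noteq> 2"
    and "CARD('n::{finite,linorder}) = n"
    and "CARD('k::{finite,linorder}) = n div 2"
    and "CARD('l::{finite,linorder}) = (n + 1) div 2"
  shows "affine hull (P_core_QTSASM TYPE('n) :: (real ^ 'k::{finite,linorder} ^ 'l::{finite,linorder}) set) = core_affine_space n \<and>
         aff_dim (P_QTSASM :: (real ^ 'n::{finite,linorder} ^ 'n::{finite,linorder}) set) = \<lfloor>(real n - 1)\<^sup>2 / 4\<rfloor> - 2"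
proof
  let ?S = "{X :: real ^ 'n::{finite,linorder} ^ 'n::{finite,linorder}. is_QTSASM X}"
  let ?A = "core_affine_space n :: (real ^ 'k::{finite,linorder} ^ 'l::{finite,linorder}) set"
  have hull: "affine hull (core ` ?S) = ?A"
    by (rule affine_hull_core[OF assms])
  then show "affine hull (P_core_QTSASM TYPE('n)) = ?A"
    by (simp add: P_core_QTSASM_def)
  obtain w where "block n {1..(n + 1) div 2} w"
    using block_matching[OF refl subset_refl card_matched_all(1)[OF refl assms(2)]] by blast
  then have "core (mat_of (unfold_core n w) :: real ^ 'n::{finite,linorder} ^ 'n::{finite,linorder}) \<in> ?A"
    using assms by (intro core_QTSASM_mem block_QTSASM) auto
  then have "aff_dim ?A = int ((n + 1) div 2 * (n div 2)) - int (n div 2 + 2)"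
    by (rule aff_dim_core_affine_space[OF assms(1,2,4,5)])
  moreover have "aff_dim (P_QTSASM :: (real ^ 'n::{finite,linorder} ^ 'n::{finite,linorder}) set) = aff_dim ?A"
    unfolding P_QTSASM_def aff_dim_convex_hull hull[symmetric] aff_dim_affine_hull
    using aff_dim_core_image[OF _ assms(3-5)] assms(1) by simp
  \<comment> \<open>The number of cells of the core minus k. The remaining two equations account for
    the final -2.\<close>
  moreover have "\<lfloor>(real n - 1)\<^sup>2 / 4\<rfloor> = int ((n + 1) div 2 * (n div 2)) - int (n div 2)"
  proof (cases "even n")
    case True
    then obtain k where n: "n = 2 * k"
      by (elim evenE)
    have "(real n - 1)\<^sup>2 / 4 = of_int (int k * int k - int k) + 1 / 4"
      by (simp add: n power2_eq_square field_simps)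
    then have "\<lfloor>(real n - 1)\<^sup>2 / 4\<rfloor> = int k * int k - int k"
      by linarith
    then show ?thesis
      by (simp add: n)
  next
    case False
    then obtain k where n: "n = 2 * k + 1"
      by (elim oddE)
    have "(real n - 1)\<^sup>2 / 4 = of_int (int k * int k)"
      by (simp add: n power2_eq_square)
    then have "\<lfloor>(real n - 1)\<^sup>2 / 4\<rfloor> = int k * int k"
      by linarith
    then show ?thesis
      by (simp add: n algebra_simps)
  qed
  ultimately show "aff_dim (P_QTSASM :: (real ^ 'n::{finite,linorder} ^ 'n::{finite,linorder}) set) = \<lfloor>(real n - 1)\<^sup>2 / 4\<rfloor> - 2"
    by simp
qed

end
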